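(* Let $R$ be a super commutative ring and let $P$ be a supermodule over $R$. Then the following are equivalent: (1) $P$ is a direct summand of a free supermodule, that is, there exists a supermodule $Q$ over $R$ such that $P\oplus Q$ is isomorphic to $F$, where $F$ is a free supermodule over $R$ of type $(I,J)$ for some arbitrary sets $I,J$. (2) For all supermodules $M,N$ over $R$, every $R$-linear morphism $h:P\to N$ and every surjective $R$-linear morphism $g:M\to N$, there exists a unique $R$-linear morphism $\widetilde h:P\to M$ such that $g\circ\widetilde h=h$. (3) Every short exact sequence $0\to E_1\xrightarrow{h}E_2\xrightarrow{g}P\to 0$ of supermodules over $R$ splits, that is, there exists an $R$-linear morphism $s:P\to E_2$ such that $g\circ s=\mathrm{Id}_P$.
   Context: A superring is a ring $R$ with identity together with additive subgroups $R_0,R_1$ such that $R=R_0\oplus R_1$, $R_\alpha R_\beta\subset R_{\alpha+\beta}$ for $\alpha,\beta\in\mathbb{Z}_2$, and $1\in R_0$. Elements of $R_0\cup R_1$ are homogeneous, with $|a|=i$ for $a\in R_i$. $R$ is super commutative if $ab=(-1)^{|a||b|}ba$ for all homogeneous $a,b\in R$. A (right) supermodule over $R$ is a right $R$-module $M$ with a decomposition $M=M_0\oplus M_1$ (as additive groups) such that $M_\beta R_\alpha\subset M_{\beta+\alpha}$ for all $\alpha,\beta\in\mathbb{Z}_2$. The direct sum of supermodules is graded componentwise. An $R$-linear morphism (also called $R$-homomorphism) $\phi:M\to N$ is an additive map with $\phi(xa)=\phi(x)a$ for all $x\in M$, $a\in R$; it is not required to be homogeneous (i.e. to preserve or reverse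 the grading). Morphisms, isomorphisms and exact sequences of supermodules are taken in the category whose morphisms are the $R$-linear morphisms. A supermodule $F$ over $R$ is free of type $(I,J)$ if there are even elements $f_i^0\in F_0$ ($i\in I$) and odd elements $f_j^1\in F_1$ ($j\in J$) which together form a basis of $F$ as a right $R$-module, so that $F\cong(\bigoplus_{i\in I}f_i^0R)\oplus(\bigoplus_{j\in J}f_j^1R)$.
   Formalization: In (2) only existence of the lift is required, since with "unique" the claim fails (P = R nonzero, N = 0); the auxiliary supermodules and index sets I, J range over one arbitrarily enlargeable type, to which any given ones can be copied isomorphically. *)

theory Defs
  imports "HOL-Algebra.Ideal" "HOL-Library.Numeral_Type"
begin

text \<open>
  The degrees live in the type \<^typ>\<open>2\<close> of integers modulo 2. As for modules in HOL-Algebra,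
  the record of a supermodule inherits the fields of a ring for the sake of its additive
  structure; its fields \<^term>\<open>mult\<close> and \<^term>\<open>one\<close> are never used.
\<close>

record 'a z2graded = "'a ring" +
  gr :: "2 \<Rightarrow> 'a set"

record ('r, 'm) supermodule = "'m z2graded" +
  ract :: "'m \<Rightarrow> 'r \<Rightarrow> 'm"  (infixl "\<cdot>\<index>" 70)

definition z2_decomposition :: "('a, 'b) z2graded_scheme \<Rightarrow> bool" where
  "z2_decomposition G \<longleftrightarrow>
     (\<forall>\<alpha>. additive_subgroup (gr G \<alpha>) G) \<and>
     gr G 0 <+>\<^bsub>G\<^esub> gr G 1 = carrier G \<and>
     gr G 0 \<inter> gr G 1 = {\<zero>\<^bsub>G\<^esub>}"

locale superring = ring R for R (structure) +
  assumes decomposition: "z2_decomposition R"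
    and mult_graded: "\<lbrakk>a \<in> gr R \<alpha>; b \<in> gr R \<beta>\<rbrakk> \<Longrightarrow> a \<otimes> b \<in> gr R (\<alpha> + \<beta>)"
    and one_even: "\<one> \<in> gr R 0"

text \<open>The sign \<open>(-1)^(\<alpha>\<beta>)\<close> is negative exactly if \<open>\<alpha>\<beta> = 1\<close> modulo 2.\<close>

locale supercommutative_ring = superring +
  assumes supercomm: "\<lbrakk>a \<in> gr R \<alpha>; b \<in> gr R \<beta>\<rbrakk> \<Longrightarrow>
    a \<otimes> b = (if \<alpha> * \<beta> = 1 then \<ominus> (b \<otimes> a) else b \<otimes> a)"

locale supermodule = R: superring R + M: abelian_group M for R and M (structure) +
  assumes ract_closed: "\<lbrakk>x \<in> carrier M; a \<in> carrier R\<rbrakk> \<Longrightarrow> x \<cdot> a \<in> carrier M"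
    and ract_add_left: "\<lbrakk>x \<in> carrier M; y \<in> carrier M; a \<in> carrier R\<rbrakk> \<Longrightarrow>
      (x \<oplus> y) \<cdot> a = x \<cdot> a \<oplus> y \<cdot> a"
    and ract_add_right: "\<lbrakk>x \<in> carrier M; a \<in> carrier R; b \<in> carrier R\<rbrakk> \<Longrightarrow>
      x \<cdot> (a \<oplus>\<^bsub>R\<^esub> b) = x \<cdot> a \<oplus> x \<cdot> b"
    and ract_mult: "\<lbrakk>x \<in> carrier M; a \<in> carrier R; b \<in> carrier R\<rbrakk> \<Longrightarrow>
      x \<cdot> (a \<otimes>\<^bsub>R\<^esub> b) = (x \<cdot> a) \<cdot> b"
    and ract_one: "x \<in> carrier M \<Longrightarrow> x \<cdot> \<one>\<^bsub>R\<^esub> = x"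
    and decomposition: "z2_decomposition M"
    and ract_graded: "\<lbrakk>x \<in> gr M \<beta>; a \<in> gr R \<alpha>\<rbrakk> \<Longrightarrow> x \<cdot> a \<in> gr M (\<beta> + \<alpha>)"

text \<open>Linear morphisms need not respect the grading.\<close>

definition lin_hom ::
  "('r, 'a) z2graded_scheme \<Rightarrow> ('r, 'm, 'b) supermodule_scheme \<Rightarrow>
   ('r, 'n, 'c) supermodule_scheme \<Rightarrow> ('m \<Rightarrow> 'n) set" where
  "lin_hom R M N = {h \<in> carrier M \<rightarrow> carrier N.
     (\<forall>x \<in> carrier M. \<forall>y \<in> carrier M. h (x \<oplus>\<^bsub>M\<^esub> y) = h x \<oplus>\<^bsub>N\<^esub> h y) \<and>
     (\<forall>x \<in> carrier M. \<forall>a \<in> carrier R. h (x \<cdot>\<^bsub>M\<^esub> a) = h x \<cdot>\<^bsub>N\<^esub> a)}"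

definition lin_iso ::
  "('r, 'a) z2graded_scheme \<Rightarrow> ('r, 'm, 'b) supermodule_scheme \<Rightarrow>
   ('r, 'n, 'c) supermodule_scheme \<Rightarrow> bool" where
  "lin_iso R M N \<longleftrightarrow> (\<exists>h \<in> lin_hom R M N. bij_betw h (carrier M) (carrier N))"

definition direct_sum ::
  "('r, 'm, 'b) supermodule_scheme \<Rightarrow> ('r, 'n, 'c) supermodule_scheme \<Rightarrow>
   ('r, 'm \<times> 'n) supermodule" where
  "direct_sum M N =
    \<lparr>carrier = carrier M \<times> carrier N,
     mult = undefined,
     one = undefined,
     zero = (\<zero>\<^bsub>M\<^esub>, \<zero>\<^bsub>N\<^esub>),
     add = (\<lambda>(x, y) (x', y'). (x \<oplus>\<^bsub>M\<^esub> x', y \<oplus>\<^bsub>N\<^esub> y')),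
     gr = (\<lambda>\<alpha>. gr M \<alpha> \<times> gr N \<alpha>),
     ract = (\<lambda>(x, y) a. (x \<cdot>\<^bsub>M\<^esub> a, y \<cdot>\<^bsub>N\<^esub> a))\<rparr>"

definition coeffs :: "('r, 'a) z2graded_scheme \<Rightarrow> 'k set \<Rightarrow> ('k \<Rightarrow> 'r) set" where
  "coeffs R K = {c \<in> K \<rightarrow> carrier R. finite {k \<in> K. c k \<noteq> \<zero>\<^bsub>R\<^esub>}}"

definition lincomb ::
  "('r, 'a) z2graded_scheme \<Rightarrow> ('r, 'm, 'b) supermodule_scheme \<Rightarrow> 'k set \<Rightarrow>
   ('k \<Rightarrow> 'm) \<Rightarrow> ('k \<Rightarrow> 'r) \<Rightarrow> 'm" where
  "lincomb R M K f c = (\<Oplus>\<^bsub>M\<^esub>k \<in> {k \<in> K. c k \<noteq> \<zero>\<^bsub>R\<^esub>}. f k \<cdot>\<^bsub>M\<^esub> c k)"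

definition is_basis ::
  "('r, 'a) z2graded_scheme \<Rightarrow> ('r, 'm, 'b) supermodule_scheme \<Rightarrow> 'k set \<Rightarrow>
   ('k \<Rightarrow> 'm) \<Rightarrow> bool" where
  "is_basis R M K f \<longleftrightarrow>
     f \<in> K \<rightarrow> carrier M \<and>
     (\<forall>x \<in> carrier M. \<exists>c \<in> coeffs R K. x = lincomb R M K f c) \<and>
     (\<forall>c \<in> coeffs R K. lincomb R M K f c = \<zero>\<^bsub>M\<^esub> \<longrightarrow> (\<forall>k \<in> K. c k = \<zero>\<^bsub>R\<^esub>))"

definition free_of_type ::
  "('r, 'a) z2graded_scheme \<Rightarrow> ('r, 'm, 'b) supermodule_scheme \<Rightarrow> 'i set \<Rightarrow> 'j set \<Rightarrow> bool" where
  "free_of_type R F I J \<longleftrightarrow> supermodule R F \<and>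
     (\<exists>f0 \<in> I \<rightarrow> gr F 0. \<exists>f1 \<in> J \<rightarrow> gr F 1. is_basis R F (I <+> J) (case_sum f0 f1))"

definition short_exact ::
  "('r, 'a) z2graded_scheme \<Rightarrow> ('r, 'm, 'b) supermodule_scheme \<Rightarrow>
   ('r, 'n, 'c) supermodule_scheme \<Rightarrow> ('r, 'p, 'd) supermodule_scheme \<Rightarrow>
   ('m \<Rightarrow> 'n) \<Rightarrow> ('n \<Rightarrow> 'p) \<Rightarrow> bool" where
  "short_exact R E1 E2 P h g \<longleftrightarrow>
     h \<in> lin_hom R E1 E2 \<and> g \<in> lin_hom R E2 P \<and>
     inj_on h (carrier E1) \<and>
     h ` carrier E1 = {x \<in> carrier E2. g x = \<zero>\<^bsub>P\<^esub>} \<and>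
     g ` carrier E2 = carrier P"

text \<open>
  HOL formulas cannot quantify over types, so in the properties below the auxiliary supermodules
  range over all supermodules with carrier in a given type \<^typ>\<open>'u\<close>, passed as a
  \<open>TYPE('u)\<close> argument. They are meant to be used with \<^typ>\<open>'u\<close> of the following form. Its
  parameter \<^typ>\<open>'x\<close> is arbitrary, so any supermodules, on whatever types, have isomorphic copies
  in such a universe for suitable \<^typ>\<open>'x\<close>. The other summands only make it large enough
  to contain a copy of \<^typ>\<open>'p\<close>, on which \<open>P\<close> lives, and of the free supermodule generated by the
  homogeneous elements of \<open>P\<close>; on small types the properties may fail to be equivalent.
\<close>

type_synonym ('r, 'p, 'x) universe = "('p \<Rightarrow> 'r) + 'p + 'x"

text \<open>
  Taking the index sets \<open>I\<close> and \<open>J\<close> in \<^typ>\<open>'u\<close> loses no generality: a basis embeds into the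
  carrier unless the ring is trivial, and then every supermodule is free of type \<open>({}, {})\<close>.
\<close>

definition summand_of_free ::
  "'u itself \<Rightarrow> ('r, 'a) z2graded_scheme \<Rightarrow> ('r, 'p, 'b) supermodule_scheme \<Rightarrow> bool" where
  "summand_of_free (_ :: 'u itself) R P \<longleftrightarrow>
     (\<exists>(Q :: ('r, 'u) supermodule) (F :: ('r, 'u) supermodule) (I :: 'u set) (J :: 'u set).
        supermodule R Q \<and> free_of_type R F I J \<and> lin_iso R (direct_sum P Q) F)"

definition lifting_property ::
  "'u itself \<Rightarrow> ('r, 'a) z2graded_scheme \<Rightarrow> ('r, 'p, 'b) supermodule_scheme \<Rightarrow> bool" where
  "lifting_property (_ :: 'u itself) R P \<longleftrightarrow>
     (\<forall>(M :: ('r, 'u) supermodule) (N :: ('r, 'u) supermodule) h g.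
        supermodule R M \<longrightarrow> supermodule R N \<longrightarrow>
        h \<in> lin_hom R P N \<longrightarrow> g \<in> lin_hom R M N \<longrightarrow> g ` carrier M = carrier N \<longrightarrow>
        (\<exists>h' \<in> lin_hom R P M. \<forall>x \<in> carrier P. g (h' x) = h x))"

definition sequences_split ::
  "'u itself \<Rightarrow> ('r, 'a) z2graded_scheme \<Rightarrow> ('r, 'p, 'b) supermodule_scheme \<Rightarrow> bool" where
  "sequences_split (_ :: 'u itself) R P \<longleftrightarrow>
     (\<forall>(E1 :: ('r, 'u) supermodule) (E2 :: ('r, 'u) supermodule) h g.
        supermodule R E1 \<longrightarrow> supermodule R E2 \<longrightarrow> short_exact R E1 E2 P h g \<longrightarrow>
        (\<exists>s \<in> lin_hom R P E2. \<forall>x \<in> carrier P. g (s x) = x))"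

text \<open>
  The lifting property asks for the existence of a lift only. Requiring the lift to be unique as
  well, as some sources literally do, would force \<open>P = 0\<close>: lift the zero morphism along \<open>P \<rightarrow> 0\<close>.
\<close>

lemma unique_lifting_trivial:
  fixes P :: "('r, 'p) supermodule"
  assumes P: "supermodule R P"
    and unique: "\<And>(M :: ('r, 'p) supermodule) (N :: ('r, 'p) supermodule) h g h1 h2 x.
      \<lbrakk>supermodule R M; supermodule R N; h \<in> lin_hom R P N; g \<in> lin_hom R M N;
       g ` carrier M = carrier N;
       h1 \<in> lin_hom R P M; \<forall>x \<in> carrier P. g (h1 x) = h x;
       h2 \<in> lin_hom R P M; \<forall>x \<in> carrier P. g (h2 x) = h x;
       x \<in> carrier P\<rbrakk> \<Longrightarrow> h1 x = h2 x"
  shows "carrier P = {\<zero>\<^bsub>P\<^esub>}"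
proof -
  interpret P: supermodule R P by (rule P)
  define Z where "Z = P\<lparr>carrier := {\<zero>\<^bsub>P\<^esub>}, gr := \<lambda>_. {\<zero>\<^bsub>P\<^esub>}\<rparr>"
  have Z_simps: "carrier Z = {\<zero>\<^bsub>P\<^esub>}" "gr Z = (\<lambda>_. {\<zero>\<^bsub>P\<^esub>})" "zero Z = zero P"
      "add Z = add P" "ract Z = ract P"
    by (simp_all add: Z_def)
  have zero_ract: "\<zero>\<^bsub>P\<^esub> \<cdot>\<^bsub>P\<^esub> a = \<zero>\<^bsub>P\<^esub>" if "a \<in> carrier R" for a
    using P.ract_add_left[of "\<zero>\<^bsub>P\<^esub>" "\<zero>\<^bsub>P\<^esub>" a] P.ract_closed[of "\<zero>\<^bsub>P\<^esub>" a] that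
    by (metis P.M.add.l_cancel_one' P.M.l_zero P.M.zero_closed)
  have gr_R: "gr R \<alpha> \<subseteq> carrier R" for \<alpha>
    using P.R.decomposition by (simp add: z2_decomposition_def additive_subgroup.a_subset)
  have Z_group: "abelian_group Z"
    by (rule abelian_groupI) (auto simp: Z_simps)
  have "additive_subgroup {\<zero>\<^bsub>P\<^esub>} Z"
    using group.subgroup_self[OF abelian_group.a_group[OF Z_group]]
    by (simp add: additive_subgroup_def Z_simps)
  then have "z2_decomposition Z"
    by (auto simp: z2_decomposition_def Z_simps set_add_def set_mult_def)
  then have Z: "supermodule R Z"
    using Z_group P.R.superring_axioms gr_R
    by (intro supermodule.intro supermodule_axioms.intro)
       (auto simp: Z_simps zero_ract P.ract_one subset_iff)
  have zero_hom: "(\<lambda>_. \<zero>\<^bsub>P\<^esub>) \<in> lin_hom R P Z" "(\<lambda>_. \<zero>\<^bsub>P\<^esub>) \<in> lin_hom R P P"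
    by (auto simp: lin_hom_def Z_simps zero_ract)
  have id_hom: "(\<lambda>x. x) \<in> lin_hom R P P"
    by (auto simp: lin_hom_def)
  have "x = \<zero>\<^bsub>P\<^esub>" if "x \<in> carrier P" for x
    using unique[OF P Z zero_hom(1) zero_hom(1) _ id_hom _ zero_hom(2) _ that] that
    by (auto simp: Z_simps)
  then show ?thesis by auto
qed

end

theory Submission
  imports Defs
begin

text \<open>
  The classical characterisation of projective modules carries over because morphisms need not
  respect the grading: most of the argument forgets it. A morphism out of a free supermodule can
  be prescribed arbitrarily on a basis, so it lifts along every surjection, and liftings pass to
  retracts, in particular to direct summands (\<open>basis_lift\<close>, \<open>summand_of_free_lifting\<close>). Lifting the
  identity of \<open>P\<close> along \<open>g : E\<^sub>2 \<rightarrow> P\<close> splits a short exact sequence (\<open>lifting_sequences_split\<close>).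

  The grading matters when a complement of \<open>P\<close> has to be found, since the complement must itself
  be a supermodule. Cover \<open>P\<close> by the free supermodule \<open>F\<close> on the homogeneous elements of \<open>P\<close>, each
  generator having the degree of the element it names. Evaluation \<open>F \<rightarrow> P\<close> is then homogeneous of
  degree \<open>0\<close> (\<open>free_cover_eval\<close>), so its kernel \<open>Q\<close> is a graded submodule (\<open>supermodule_kernel\<close>).
  Evaluation is onto since the homogeneous elements of \<open>P\<close> generate it. If the resulting exact
  sequence is split by \<open>s\<close>, then \<open>(x, q) \<mapsto> s x + q\<close> is an isomorphism from \<open>P \<oplus> Q\<close> to \<open>F\<close>
  (\<open>split_kernel_iso\<close>, \<open>sequences_split_summand\<close>), even if \<open>s\<close> is not homogeneous.

  The auxiliary supermodules must live on one prescribed type. Both \<open>P\<close> and \<open>F\<close>, which consists of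
  finitely supported functions on the carrier type of \<open>P\<close>, are therefore copied into that type along
  injections (\<open>copy_along\<close>).
\<close>


section \<open>Gradings\<close>

lemma two_cases: "(\<alpha> :: 2) = 0 \<or> \<alpha> = 1"
proof (cases \<alpha>)
  case (of_int z)
  then have "z = 0 \<or> z = 1" by auto
  with of_int show ?thesis by auto
qed

lemma two_minus_one: "(- 1 :: 2) = 1"
proof -
  have "(1 :: 2) + 1 = 0" by simp
  then show ?thesis by (metis minus_unique)
qed

text \<open>
  Closure under negation is asked for as existence of inverses: in a record built from operations
  the additive inverse is only available through its characterising equation.
\<close>

lemma z2_decompositionI:
  assumes G: "abelian_group G"
    and sub: "\<And>\<alpha>. gr G \<alpha> \<subseteq> carrier G"
    and zero: "\<And>\<alpha>. \<zero>\<^bsub>G\<^esub> \<in> gr G \<alpha>"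
    and add: "\<And>\<alpha> x y. \<lbrakk>x \<in> gr G \<alpha>; y \<in> gr G \<alpha>\<rbrakk> \<Longrightarrow> x \<oplus>\<^bsub>G\<^esub> y \<in> gr G \<alpha>"
    and neg: "\<And>\<alpha> x. x \<in> gr G \<alpha> \<Longrightarrow> \<exists>y \<in> gr G \<alpha>. y \<oplus>\<^bsub>G\<^esub> x = \<zero>\<^bsub>G\<^esub>"
    and decomp: "\<And>x. x \<in> carrier G \<Longrightarrow> \<exists>x0 \<in> gr G 0. \<exists>x1 \<in> gr G 1. x = x0 \<oplus>\<^bsub>G\<^esub> x1"
    and disjoint: "\<And>x. \<lbrakk>x \<in> gr G 0; x \<in> gr G 1\<rbrakk> \<Longrightarrow> x = \<zero>\<^bsub>G\<^esub>"
  shows "z2_decomposition G"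
proof -
  interpret abelian_group G by (rule G)
  have "additive_subgroup (gr G \<alpha>) G" for \<alpha>
  proof (rule additive_subgroupI, rule add.subgroupI)
    show "gr G \<alpha> \<subseteq> carrier G" by (rule sub)
    show "gr G \<alpha> \<noteq> {}" using zero by blast
    fix x assume x: "x \<in> gr G \<alpha>"
    from neg[OF x] obtain y where y: "y \<in> gr G \<alpha>" "y \<oplus>\<^bsub>G\<^esub> x = \<zero>\<^bsub>G\<^esub>" by blast
    then have "\<ominus>\<^bsub>G\<^esub> x = y" using x sub by (intro minus_equality) auto
    then show "\<ominus>\<^bsub>G\<^esub> x \<in> gr G \<alpha>" using y by simp
  next
    fix x y assume "x \<in> gr G \<alpha>" "y \<in> gr G \<alpha>"
    then show "x \<oplus>\<^bsub>G\<^esub> y \<in> gr G \<alpha>" by (rule add)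
  qed
  moreover have "set_add G (gr G 0) (gr G 1) = carrier G"
  proof
    show "set_add G (gr G 0) (gr G 1) \<subseteq> carrier G"
      using sub by (auto simp: set_add_def set_mult_def intro!: a_closed)
    show "carrier G \<subseteq> set_add G (gr G 0) (gr G 1)"
      using decomp by (auto simp: set_add_def set_mult_def)
  qed
  moreover have "gr G 0 \<inter> gr G 1 = {\<zero>\<^bsub>G\<^esub>}"
    using zero disjoint by blast
  ultimately show ?thesis by (simp add: z2_decomposition_def)
qed

lemma z2_subset: "z2_decomposition G \<Longrightarrow> gr G \<alpha> \<subseteq> carrier G"
  by (simp add: z2_decomposition_def additive_subgroup.a_subset)

lemma z2_zero: "z2_decomposition G \<Longrightarrow> \<zero>\<^bsub>G\<^esub> \<in> gr G \<alpha>"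
  by (simp add: z2_decomposition_def additive_subgroup.zero_closed)

lemma z2_add:
  "\<lbrakk>z2_decomposition G; x \<in> gr G \<alpha>; y \<in> gr G \<alpha>\<rbrakk> \<Longrightarrow> x \<oplus>\<^bsub>G\<^esub> y \<in> gr G \<alpha>"
  by (simp add: z2_decomposition_def additive_subgroup.a_closed)

lemma z2_neg:
  assumes "z2_decomposition G" "abelian_group G" "x \<in> gr G \<alpha>"
  shows "\<ominus>\<^bsub>G\<^esub> x \<in> gr G \<alpha>"
  using assms by (simp add: z2_decomposition_def additive_subgroup.a_inv_closed)

lemma z2_obtain:
  assumes "z2_decomposition G" "x \<in> carrier G"
  obtains x0 x1 where "x0 \<in> gr G 0" "x1 \<in> gr G 1" "x = x0 \<oplus>\<^bsub>G\<^esub> x1"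
proof -
  have "x \<in> set_add G (gr G 0) (gr G 1)"
    using assms by (simp add: z2_decomposition_def)
  then show ?thesis using that by (auto simp: set_add_def set_mult_def)
qed

lemma z2_disjoint:
  "\<lbrakk>z2_decomposition G; x \<in> gr G 0; x \<in> gr G 1\<rbrakk> \<Longrightarrow> x = \<zero>\<^bsub>G\<^esub>"
  by (auto simp: z2_decomposition_def)

lemma finsum_in_gr:
  assumes "z2_decomposition G" "abelian_group G" "\<And>k. k \<in> A \<Longrightarrow> f k \<in> gr G \<alpha>"
  shows "finsum G f A \<in> gr G \<alpha>"
proof -
  interpret abelian_group G by fact
  show ?thesis using assms(3)
  proof (induction A rule: infinite_finite_induct)
    case (insert a A)
    then show ?case
      using z2_subset[OF assms(1)] z2_add[OF assms(1)]
      by (subst finsum_insert) (auto simp: Pi_iff subset_iff)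
  qed (simp_all add: z2_zero[OF assms(1)])
qed


section \<open>Linear morphisms\<close>

lemma lin_homI:
  assumes "\<And>x. x \<in> carrier M \<Longrightarrow> h x \<in> carrier N"
    and "\<And>x y. \<lbrakk>x \<in> carrier M; y \<in> carrier M\<rbrakk> \<Longrightarrow> h (x \<oplus>\<^bsub>M\<^esub> y) = h x \<oplus>\<^bsub>N\<^esub> h y"
    and "\<And>x a. \<lbrakk>x \<in> carrier M; a \<in> carrier R\<rbrakk> \<Longrightarrow> h (x \<cdot>\<^bsub>M\<^esub> a) = h x \<cdot>\<^bsub>N\<^esub> a"
  shows "h \<in> lin_hom R M N"
  using assms by (auto simp: lin_hom_def)

lemma lin_hom_closed: "\<lbrakk>h \<in> lin_hom R M N; x \<in> carrier M\<rbrakk> \<Longrightarrow> h x \<in> carrier N"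
  and lin_hom_add:
    "\<lbrakk>h \<in> lin_hom R M N; x \<in> carrier M; y \<in> carrier M\<rbrakk> \<Longrightarrow> h (x \<oplus>\<^bsub>M\<^esub> y) = h x \<oplus>\<^bsub>N\<^esub> h y"
  and lin_hom_ract:
    "\<lbrakk>h \<in> lin_hom R M N; x \<in> carrier M; a \<in> carrier R\<rbrakk> \<Longrightarrow> h (x \<cdot>\<^bsub>M\<^esub> a) = h x \<cdot>\<^bsub>N\<^esub> a"
  by (auto simp: lin_hom_def)

lemma lin_hom_compose:
  "\<lbrakk>h \<in> lin_hom R M N; k \<in> lin_hom R N L\<rbrakk> \<Longrightarrow> (\<lambda>x. k (h x)) \<in> lin_hom R M L"
  by (auto simp: lin_hom_def Pi_iff)

lemma lin_hom_inv_into: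
  assumes h: "h \<in> lin_hom R M N" and bij: "bij_betw h (carrier M) (carrier N)"
    and add_closed: "\<And>x y. \<lbrakk>x \<in> carrier M; y \<in> carrier M\<rbrakk> \<Longrightarrow> x \<oplus>\<^bsub>M\<^esub> y \<in> carrier M"
    and ract_closed: "\<And>x a. \<lbrakk>x \<in> carrier M; a \<in> carrier R\<rbrakk> \<Longrightarrow> x \<cdot>\<^bsub>M\<^esub> a \<in> carrier M"
  shows "inv_into (carrier M) h \<in> lin_hom R N M"
proof (rule lin_homI)
  note inj = bij_betw_imp_inj_on[OF bij]
  have closed: "inv_into (carrier M) h y \<in> carrier M"
    and inverse: "h (inv_into (carrier M) h y) = y" if "y \<in> carrier N" for y
    using that bij by (auto simp: bij_betw_def inv_into_into f_inv_into_f)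
  show "inv_into (carrier M) h y \<in> carrier M" if "y \<in> carrier N" for y
    using that by (rule closed)
  fix x y assume "x \<in> carrier N" "y \<in> carrier N"
  then show "inv_into (carrier M) h (x \<oplus>\<^bsub>N\<^esub> y) =
      inv_into (carrier M) h x \<oplus>\<^bsub>M\<^esub> inv_into (carrier M) h y"
    by (intro inv_into_f_eq[OF inj]) (auto simp: closed inverse add_closed lin_hom_add[OF h])
next
  note inj = bij_betw_imp_inj_on[OF bij]
  fix y a assume "y \<in> carrier N" "a \<in> carrier R"
  then show "inv_into (carrier M) h (y \<cdot>\<^bsub>N\<^esub> a) = inv_into (carrier M) h y \<cdot>\<^bsub>M\<^esub> a"
    using bij
    by (intro inv_into_f_eq[OF inj])
       (auto simp: bij_betw_def inv_into_into f_inv_into_f ract_closed lin_hom_ract[OF h])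
qed

lemma additive_zero:
  assumes "abelian_group G" "abelian_group H" "h \<in> carrier G \<rightarrow> carrier H"
    and "\<And>x y. \<lbrakk>x \<in> carrier G; y \<in> carrier G\<rbrakk> \<Longrightarrow> h (x \<oplus>\<^bsub>G\<^esub> y) = h x \<oplus>\<^bsub>H\<^esub> h y"
  shows "h \<zero>\<^bsub>G\<^esub> = \<zero>\<^bsub>H\<^esub>"
proof -
  interpret G: abelian_group G by fact
  interpret H: abelian_group H by fact
  have "h \<zero>\<^bsub>G\<^esub> \<oplus>\<^bsub>H\<^esub> h \<zero>\<^bsub>G\<^esub> = h \<zero>\<^bsub>G\<^esub>"
    using assms(4)[of "\<zero>\<^bsub>G\<^esub>" "\<zero>\<^bsub>G\<^esub>"] by simp
  then show ?thesis using assms(3) by (auto simp: Pi_iff)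
qed

lemma additive_finsum:
  assumes "abelian_group G" "abelian_group H" "h \<in> carrier G \<rightarrow> carrier H"
    and "\<And>x y. \<lbrakk>x \<in> carrier G; y \<in> carrier G\<rbrakk> \<Longrightarrow> h (x \<oplus>\<^bsub>G\<^esub> y) = h x \<oplus>\<^bsub>H\<^esub> h y"
    and "f \<in> A \<rightarrow> carrier G"
  shows "h (finsum G f A) = finsum H (\<lambda>k. h (f k)) A"
proof -
  interpret G: abelian_group G by fact
  interpret H: abelian_group H by fact
  show ?thesis using assms(5)
  proof (induction A rule: infinite_finite_induct)
    case (insert a A)
    then show ?case using assms(3,4) by (simp add: Pi_iff G.finsum_closed)
  qed (simp_all add: additive_zero[OF assms(1-4)])
qed

lemma lin_hom_zero:
  assumes "supermodule R M" "supermodule R N" "h \<in> lin_hom R M N"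
  shows "h \<zero>\<^bsub>M\<^esub> = \<zero>\<^bsub>N\<^esub>"
  using assms by (intro additive_zero) (auto simp: supermodule_def lin_hom_def)

context supermodule
begin

lemmas gr_subset = z2_subset[OF decomposition]
lemmas gr_R_subset = z2_subset[OF R.decomposition]

lemma zero_ract: "a \<in> carrier R \<Longrightarrow> \<zero> \<cdot> a = \<zero>"
  by (rule additive_zero[OF M.abelian_group_axioms M.abelian_group_axioms])
     (auto simp: ract_closed ract_add_left)

lemma ract_zero: "x \<in> carrier M \<Longrightarrow> x \<cdot> \<zero>\<^bsub>R\<^esub> = \<zero>"
  by (rule additive_zero[OF R.abelian_group_axioms M.abelian_group_axioms])
     (auto simp: ract_closed ract_add_right)

lemma finsum_ract:
  "\<lbrakk>f \<in> A \<rightarrow> carrier M; a \<in> carrier R\<rbrakk> \<Longrightarrow> (\<Oplus>k\<in>A. f k) \<cdot> a = (\<Oplus>k\<in>A. f k \<cdot> a)"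
  by (rule additive_finsum[OF M.abelian_group_axioms M.abelian_group_axioms])
     (auto simp: ract_closed ract_add_left)


end


section \<open>Linear combinations and bases\<close>

context superring
begin

lemma coeffs_add:
  assumes "c \<in> coeffs R K" "c' \<in> coeffs R K"
  shows "(\<lambda>k. c k \<oplus> c' k) \<in> coeffs R K"
proof -
  have "{k \<in> K. c k \<oplus> c' k \<noteq> \<zero>} \<subseteq>
      {k \<in> K. c k \<noteq> \<zero>} \<union> {k \<in> K. c' k \<noteq> \<zero>}" by auto
  then show ?thesis using assms
    by (auto simp: coeffs_def Pi_iff intro: finite_subset)
qed

lemma coeffs_neg: "c \<in> coeffs R K \<Longrightarrow> (\<lambda>k. \<ominus> c k) \<in> coeffs R K"
  by (auto simp: coeffs_def Pi_iff elim: rev_finite_subset)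

lemma coeffs_mult:
  assumes "c \<in> coeffs R K" "a \<in> carrier R"
  shows "(\<lambda>k. c k \<otimes> a) \<in> coeffs R K"
  using assms by (auto simp: coeffs_def Pi_iff elim: rev_finite_subset)

text \<open>
  Homogeneous components chosen for all ring elements at once. The components of \<open>\<zero>\<close> are \<open>\<zero>\<close>, so
  that taking components coefficientwise does not enlarge the support of a family.
\<close>

lemma gr_parts:
  obtains p where "\<And>\<alpha> r. r \<in> carrier R \<Longrightarrow> p \<alpha> r \<in> gr R \<alpha>"
    and "\<And>r. r \<in> carrier R \<Longrightarrow> p 0 r \<oplus> p 1 r = r" and "\<And>\<alpha>. p \<alpha> \<zero> = \<zero>"
proof -
  have "\<forall>r\<in>carrier R. \<exists>q. fst q \<in> gr R 0 \<and> snd q \<in> gr R 1 \<and> fst q \<oplus> snd q = r"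
    by (auto elim!: z2_obtain[OF decomposition])
  from bchoice[OF this] obtain q where q: "\<And>r. r \<in> carrier R \<Longrightarrow>
      fst (q r) \<in> gr R 0 \<and> snd (q r) \<in> gr R 1 \<and> fst (q r) \<oplus> snd (q r) = r"
    by blast
  define p where "p \<alpha> r = (if r = \<zero> then \<zero> else if \<alpha> = 0 then fst (q r) else snd (q r))"
    for \<alpha> :: 2 and r
  show ?thesis
  proof
    show "p \<alpha> r \<in> gr R \<alpha>" if "r \<in> carrier R" for \<alpha> r
      using q[OF that] two_cases[of \<alpha>] z2_zero[OF decomposition] by (auto simp: p_def)
    show "p 0 r \<oplus> p 1 r = r" if "r \<in> carrier R" for r
      using q[OF that] by (simp add: p_def)
  qed (simp add: p_def)
qed

end

context supermodule
begin

text \<open>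
  Families may differ in their supports, so their linear combinations are comparable only after both
  sums are extended to a common finite index set.
\<close>

lemma lincomb_superset:
  assumes "f \<in> K \<rightarrow> carrier M" "c \<in> K \<rightarrow> carrier R"
    and "finite A" "{k \<in> K. c k \<noteq> \<zero>\<^bsub>R\<^esub>} \<subseteq> A" "A \<subseteq> K"
  shows "lincomb R M K f c = (\<Oplus>k\<in>A. f k \<cdot> c k)"
  unfolding lincomb_def
  by (rule M.add.finprod_mono_neutral_cong_left)
     (use assms in \<open>auto simp: Pi_iff ract_zero ract_closed subset_iff\<close>)

lemma lincomb_closed:
  assumes "f \<in> K \<rightarrow> carrier M" "c \<in> coeffs R K"
  shows "lincomb R M K f c \<in> carrier M"
  unfolding lincomb_def using assms
  by (intro M.finsum_closed) (auto simp: coeffs_def Pi_iff ract_closed)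

lemma lincomb_cong:
  assumes "f \<in> K \<rightarrow> carrier M" "c \<in> coeffs R K" "\<And>k. k \<in> K \<Longrightarrow> f k = f' k"
    and "\<And>k. k \<in> K \<Longrightarrow> c k = c' k"
  shows "lincomb R M K f c = lincomb R M K f' c'"
  unfolding lincomb_def using assms
  by (intro M.finsum_cong') (auto simp: coeffs_def Pi_iff ract_closed)

lemma lincomb_add:
  assumes f: "f \<in> K \<rightarrow> carrier M" and c: "c \<in> coeffs R K" "c' \<in> coeffs R K"
  shows "lincomb R M K f (\<lambda>k. c k \<oplus>\<^bsub>R\<^esub> c' k) = lincomb R M K f c \<oplus> lincomb R M K f c'"
proof -
  let ?A = "{k \<in> K. c k \<noteq> \<zero>\<^bsub>R\<^esub>} \<union> {k \<in> K. c' k \<noteq> \<zero>\<^bsub>R\<^esub>}"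
  have fin: "finite ?A" and closed: "c \<in> K \<rightarrow> carrier R" "c' \<in> K \<rightarrow> carrier R"
    using c by (auto simp: coeffs_def)
  have "lincomb R M K f (\<lambda>k. c k \<oplus>\<^bsub>R\<^esub> c' k) = (\<Oplus>k\<in>?A. f k \<cdot> (c k \<oplus>\<^bsub>R\<^esub> c' k))"
    using f closed fin by (intro lincomb_superset) (auto simp: Pi_iff)
  also have "\<dots> = (\<Oplus>k\<in>?A. f k \<cdot> c k \<oplus> f k \<cdot> c' k)"
    using f closed by (intro M.finsum_cong') (auto simp: Pi_iff ract_add_right ract_closed)
  also have "\<dots> = (\<Oplus>k\<in>?A. f k \<cdot> c k) \<oplus> (\<Oplus>k\<in>?A. f k \<cdot> c' k)"
    using f closed by (intro M.finsum_addf) (auto simp: Pi_iff ract_closed)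
  also have "\<dots> = lincomb R M K f c \<oplus> lincomb R M K f c'"
    using lincomb_superset[OF f closed(1) fin] lincomb_superset[OF f closed(2) fin] by auto
  finally show ?thesis .
qed

lemma lincomb_ract:
  assumes f: "f \<in> K \<rightarrow> carrier M" and c: "c \<in> coeffs R K" and a: "a \<in> carrier R"
  shows "lincomb R M K f (\<lambda>k. c k \<otimes>\<^bsub>R\<^esub> a) = lincomb R M K f c \<cdot> a"
proof -
  let ?A = "{k \<in> K. c k \<noteq> \<zero>\<^bsub>R\<^esub>}"
  have "lincomb R M K f (\<lambda>k. c k \<otimes>\<^bsub>R\<^esub> a) = (\<Oplus>k\<in>?A. f k \<cdot> (c k \<otimes>\<^bsub>R\<^esub> a))"
    using f c a by (intro lincomb_superset) (auto simp: Pi_iff coeffs_def)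
  also have "\<dots> = (\<Oplus>k\<in>?A. f k \<cdot> c k \<cdot> a)"
    using f c a by (intro M.finsum_cong') (auto simp: Pi_iff coeffs_def ract_mult ract_closed)
  also have "\<dots> = lincomb R M K f c \<cdot> a"
    unfolding lincomb_def
    using f c a by (intro finsum_ract[symmetric]) (auto simp: Pi_iff coeffs_def ract_closed)
  finally show ?thesis .
qed

text \<open>
  A basis of a free supermodule of type \<open>(I, J)\<close> is indexed by a disjoint sum, whereas the generators
  of the function model below form a single set with a degree function; reindexing passes from the
  second form to the first.
\<close>

lemma lincomb_reindex:
  assumes f: "f \<in> K \<rightarrow> carrier M" and c: "c \<in> coeffs R K" and \<sigma>: "bij_betw \<sigma> L K"
  shows "lincomb R M L (\<lambda>l. f (\<sigma> l)) (\<lambda>l. c (\<sigma> l)) = lincomb R M K f c"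
proof -
  let ?A = "{l \<in> L. c (\<sigma> l) \<noteq> \<zero>\<^bsub>R\<^esub>}"
  have "{k \<in> K. c k \<noteq> \<zero>\<^bsub>R\<^esub>} = \<sigma> ` ?A" and inj: "inj_on \<sigma> ?A"
    using \<sigma> by (auto simp: bij_betw_def inj_on_def)
  then have "lincomb R M K f c = (\<Oplus>k\<in>\<sigma> ` ?A. f k \<cdot> c k)"
    by (simp add: lincomb_def)
  also have "\<dots> = (\<Oplus>l\<in>?A. f (\<sigma> l) \<cdot> c (\<sigma> l))"
    using f c \<sigma> inj
    by (intro M.finsum_reindex) (auto simp: coeffs_def Pi_iff bij_betw_def intro!: ract_closed)
  finally show ?thesis by (simp add: lincomb_def)
qed

lemma basis_coeffs_unique:
  assumes basis: "is_basis R M K f" and c: "c \<in> coeffs R K" "c' \<in> coeffs R K"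
    and eq: "lincomb R M K f c = lincomb R M K f c'" and k: "k \<in> K"
  shows "c k = c' k"
proof -
  have f: "f \<in> K \<rightarrow> carrier M" using basis by (simp add: is_basis_def)
  let ?n = "\<lambda>k. \<ominus>\<^bsub>R\<^esub> c' k"
  have n: "?n \<in> coeffs R K" using c(2) by (rule R.coeffs_neg)
  have "lincomb R M K f (\<lambda>k. c k \<oplus>\<^bsub>R\<^esub> ?n k) = lincomb R M K f (\<lambda>k. c' k \<oplus>\<^bsub>R\<^esub> ?n k)"
    using f c n eq by (simp add: lincomb_add)
  also have "\<dots> = \<zero>"
    using c(2) by (auto simp: lincomb_def coeffs_def Pi_iff R.r_neg intro!: M.add.finprod_one_eqI)
  finally have "c k \<oplus>\<^bsub>R\<^esub> ?n k = \<zero>\<^bsub>R\<^esub>"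
    using basis R.coeffs_add[OF c(1) n] k by (auto simp: is_basis_def)
  moreover have "c k \<in> carrier R" "c' k \<in> carrier R"
    using c k by (auto simp: coeffs_def)
  ultimately show ?thesis
    using R.minus_equality R.add.inv_comm by fastforce
qed

lemma is_basis_reindex:
  assumes basis: "is_basis R M K f" and \<sigma>: "bij_betw \<sigma> L K"
  shows "is_basis R M L (\<lambda>l. f (\<sigma> l))"
  unfolding is_basis_def
proof (intro conjI ballI impI)
  have f: "f \<in> K \<rightarrow> carrier M" using basis by (simp add: is_basis_def)
  have im: "\<sigma> l \<in> K" if "l \<in> L" for l using \<sigma> that by (auto simp: bij_betw_def)
  show "(\<lambda>l. f (\<sigma> l)) \<in> L \<rightarrow> carrier M" using f im by auto
  {
    fix x assume "x \<in> carrier M"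
    then obtain c where c: "c \<in> coeffs R K" "x = lincomb R M K f c"
      using basis by (auto simp: is_basis_def)
    have "{k \<in> K. c k \<noteq> \<zero>\<^bsub>R\<^esub>} = \<sigma> ` {l \<in> L. c (\<sigma> l) \<noteq> \<zero>\<^bsub>R\<^esub>}"
      "inj_on \<sigma> {l \<in> L. c (\<sigma> l) \<noteq> \<zero>\<^bsub>R\<^esub>}"
      using \<sigma> by (auto simp: bij_betw_def inj_on_def)
    then have "(\<lambda>l. c (\<sigma> l)) \<in> coeffs R L"
      using c(1) im by (auto simp: coeffs_def Pi_iff finite_image_iff)
    then show "\<exists>c\<in>coeffs R L. x = lincomb R M L (\<lambda>l. f (\<sigma> l)) c"
      using lincomb_reindex[OF f c(1) \<sigma>] c(2) by metis
  next
    fix c l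
    assume c: "c \<in> coeffs R L" and zero: "lincomb R M L (\<lambda>l. f (\<sigma> l)) c = \<zero>" and l: "l \<in> L"
    let ?\<tau> = "inv_into L \<sigma>"
    have \<tau>: "bij_betw ?\<tau> K L" using \<sigma> by (rule bij_betw_inv_into)
    have inv: "\<sigma> (?\<tau> k) = k" "?\<tau> k \<in> L" if "k \<in> K" for k
      using \<sigma> that by (auto simp: bij_betw_def f_inv_into_f inv_into_into)
    have "{l \<in> L. c l \<noteq> \<zero>\<^bsub>R\<^esub>} = ?\<tau> ` {k \<in> K. c (?\<tau> k) \<noteq> \<zero>\<^bsub>R\<^esub>}"
      "inj_on ?\<tau> {k \<in> K. c (?\<tau> k) \<noteq> \<zero>\<^bsub>R\<^esub>}"
      using \<tau> by (auto simp: bij_betw_def inj_on_def)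
    then have d: "(\<lambda>k. c (?\<tau> k)) \<in> coeffs R K"
      using c inv by (auto simp: coeffs_def Pi_iff finite_image_iff)
    have "lincomb R M K f (\<lambda>k. c (?\<tau> k)) =
        lincomb R M K (\<lambda>k. f (\<sigma> (?\<tau> k))) (\<lambda>k. c (?\<tau> k))"
      using f d inv by (intro lincomb_cong) auto
    also have "\<dots> = lincomb R M L (\<lambda>l. f (\<sigma> l)) c"
      using f im c \<tau> by (intro lincomb_reindex) auto
    finally have "c (?\<tau> (\<sigma> l)) = \<zero>\<^bsub>R\<^esub>"
      using zero basis d im[OF l] by (auto simp: is_basis_def)
    then show "c l = \<zero>\<^bsub>R\<^esub>"
      using \<sigma> l by (simp add: bij_betw_def inv_into_f_f)
  }
qed

end

lemma lin_hom_lincomb: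
  assumes M: "supermodule R M" and N: "supermodule R N" and h: "h \<in> lin_hom R M N"
    and f: "f \<in> K \<rightarrow> carrier M" and c: "c \<in> coeffs R K"
  shows "h (lincomb R M K f c) = lincomb R N K (\<lambda>k. h (f k)) c"
proof -
  interpret M: supermodule R M by (rule M)
  interpret N: supermodule R N by (rule N)
  have "h (lincomb R M K f c) = (\<Oplus>\<^bsub>N\<^esub>k\<in>{k \<in> K. c k \<noteq> \<zero>\<^bsub>R\<^esub>}. h (f k \<cdot>\<^bsub>M\<^esub> c k))"
    unfolding lincomb_def using h f c
    by (intro additive_finsum[OF M.M.abelian_group_axioms N.M.abelian_group_axioms])
       (auto simp: lin_hom_def coeffs_def Pi_iff intro!: M.ract_closed)
  also have "\<dots> = lincomb R N K (\<lambda>k. h (f k)) c"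
    unfolding lincomb_def using h f c
    by (intro N.M.finsum_cong')
       (auto simp: coeffs_def Pi_iff lin_hom_ract lin_hom_closed intro!: N.ract_closed)
  finally show ?thesis .
qed

lemma is_basis_iso:
  assumes M: "supermodule R M" and N: "supermodule R N" and h: "h \<in> lin_hom R M N"
    and bij: "bij_betw h (carrier M) (carrier N)" and basis: "is_basis R M K f"
  shows "is_basis R N K (\<lambda>k. h (f k))"
  unfolding is_basis_def
proof (intro conjI ballI impI)
  interpret M: supermodule R M by (rule M)
  interpret N: supermodule R N by (rule N)
  have f: "f \<in> K \<rightarrow> carrier M" using basis by (simp add: is_basis_def)
  show "(\<lambda>k. h (f k)) \<in> K \<rightarrow> carrier N" using f h by (auto simp: lin_hom_def)
  {
    fix y assume "y \<in> carrier N"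
    then obtain x where "x \<in> carrier M" "y = h x" using bij by (auto simp: bij_betw_def)
    moreover from this obtain c where "c \<in> coeffs R K" "x = lincomb R M K f c"
      using basis by (auto simp: is_basis_def)
    ultimately show "\<exists>c\<in>coeffs R K. y = lincomb R N K (\<lambda>k. h (f k)) c"
      using lin_hom_lincomb[OF M N h f] by blast
  next
    fix c k
    assume c: "c \<in> coeffs R K" and zero: "lincomb R N K (\<lambda>k. h (f k)) c = \<zero>\<^bsub>N\<^esub>" and k: "k \<in> K"
    have "h (lincomb R M K f c) = h \<zero>\<^bsub>M\<^esub>"
      using zero lin_hom_lincomb[OF M N h f c] lin_hom_zero[OF M N h] by simp
    then have "lincomb R M K f c = \<zero>\<^bsub>M\<^esub>"
      using bij M.lincomb_closed[OF f c] by (auto simp: bij_betw_def inj_on_def)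
    then show "c k = \<zero>\<^bsub>R\<^esub>" using basis c k by (auto simp: is_basis_def)
  }
qed


section \<open>Lifting from free supermodules and their summands\<close>

text \<open>
  Choose preimages of the images of the basis elements under \<open>h\<close>, and send a linear combination of
  the basis to the same combination of these preimages. Uniqueness of coordinates makes this linear.
\<close>

lemma basis_lift:
  assumes F: "supermodule R F" and basis: "is_basis R F K f"
    and M: "supermodule R M" and N: "supermodule R N"
    and h: "h \<in> lin_hom R F N" and g: "g \<in> lin_hom R M N" and surj: "g ` carrier M = carrier N"
  shows "\<exists>h' \<in> lin_hom R F M. \<forall>x \<in> carrier F. g (h' x) = h x"
proof -
  interpret F: supermodule R F by (rule F)
  interpret M: supermodule R M by (rule M)
  interpret N: supermodule R N by (rule N)
  have f: "f \<in> K \<rightarrow> carrier F" using basis by (simp add: is_basis_def)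
  have "\<forall>k\<in>K. \<exists>m\<in>carrier M. g m = h (f k)"
  proof
    fix k assume "k \<in> K"
    then have "h (f k) \<in> g ` carrier M" using surj f lin_hom_closed[OF h] by auto
    then show "\<exists>m\<in>carrier M. g m = h (f k)" by auto
  qed
  then obtain m where "\<forall>k\<in>K. m k \<in> carrier M \<and> g (m k) = h (f k)"
    by (auto dest: bchoice simp: Bex_def)
  then have m: "\<And>k. k \<in> K \<Longrightarrow> m k \<in> carrier M" "\<And>k. k \<in> K \<Longrightarrow> g (m k) = h (f k)"
    by auto
  then have m': "m \<in> K \<rightarrow> carrier M" by auto
  have "\<forall>x\<in>carrier F. \<exists>c\<in>coeffs R K. x = lincomb R F K f c"
    using basis by (simp add: is_basis_def)
  then obtain coords
    where "\<forall>x\<in>carrier F. coords x \<in> coeffs R K \<and> x = lincomb R F K f (coords x)"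
    by (auto dest: bchoice simp: Bex_def)
  then have coords: "\<And>x. x \<in> carrier F \<Longrightarrow> coords x \<in> coeffs R K"
      "\<And>x. x \<in> carrier F \<Longrightarrow> lincomb R F K f (coords x) = x"
    by auto
  define h' where "h' x = lincomb R M K m (coords x)" for x
  have h'_eq: "h' x = lincomb R M K m c"
    if "c \<in> coeffs R K" "lincomb R F K f c = x" "x \<in> carrier F" for x c
    unfolding h'_def using that coords m'
    by (intro M.lincomb_cong F.basis_coeffs_unique[OF basis]) simp_all
  have "h' \<in> lin_hom R F M"
  proof (rule lin_homI)
    show "h' x \<in> carrier M" if "x \<in> carrier F" for x
      unfolding h'_def using that coords m' by (intro M.lincomb_closed) auto
    show "h' (x \<oplus>\<^bsub>F\<^esub> y) = h' x \<oplus>\<^bsub>M\<^esub> h' y" if "x \<in> carrier F" "y \<in> carrier F" for x y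
    proof -
      have "h' (x \<oplus>\<^bsub>F\<^esub> y) = lincomb R M K m (\<lambda>k. coords x k \<oplus>\<^bsub>R\<^esub> coords y k)"
        using that coords f by (intro h'_eq) (auto simp: F.R.coeffs_add F.lincomb_add)
      then show ?thesis using that coords m' by (simp add: M.lincomb_add h'_def)
    qed
    show "h' (x \<cdot>\<^bsub>F\<^esub> a) = h' x \<cdot>\<^bsub>M\<^esub> a" if "x \<in> carrier F" "a \<in> carrier R" for x a
    proof -
      have "h' (x \<cdot>\<^bsub>F\<^esub> a) = lincomb R M K m (\<lambda>k. coords x k \<otimes>\<^bsub>R\<^esub> a)"
        using that coords f
        by (intro h'_eq) (auto simp: F.R.coeffs_mult F.lincomb_ract F.ract_closed)
      then show ?thesis using that coords m' by (simp add: M.lincomb_ract h'_def)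
    qed
  qed
  moreover have "g (h' x) = h x" if x: "x \<in> carrier F" for x
  proof -
    have "g (h' x) = lincomb R N K (\<lambda>k. g (m k)) (coords x)"
      unfolding h'_def using coords x m' by (intro lin_hom_lincomb[OF M N g]) auto
    also have "\<dots> = lincomb R N K (\<lambda>k. h (f k)) (coords x)"
      using m coords x f lin_hom_closed[OF h] by (intro N.lincomb_cong) (auto simp: Pi_iff)
    also have "\<dots> = h (lincomb R F K f (coords x))"
      using coords x f by (intro lin_hom_lincomb[OF F N h, symmetric]) auto
    finally show ?thesis using coords x by simp
  qed
  ultimately show ?thesis by blast
qed

text \<open>
  An isomorphism of \<open>P \<oplus> Q\<close> with \<open>F\<close> exhibits \<open>P\<close> as a retract of \<open>F\<close>: extend \<open>h\<close> to \<open>F\<close> along the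
  retraction, lift there, and restrict the lift to \<open>P\<close>. The lifted morphisms may live on any type
  \<open>'v\<close>, since the lift is built from a basis of \<open>F\<close> and not from copies of \<open>F\<close>.
\<close>

lemma summand_of_free_lifting:
  fixes P :: "('r, 'p, 'b) supermodule_scheme"
  assumes P: "supermodule R P" and summand: "summand_of_free TYPE('u) R P"
  shows "lifting_property TYPE('v) R P"
proof -
  interpret P: supermodule R P by (rule P)
  obtain Q F :: "('r, 'u) supermodule" and I J :: "'u set" and \<phi>
    where Q: "supermodule R Q" and free: "free_of_type R F I J"
      and \<phi>: "\<phi> \<in> lin_hom R (direct_sum P Q) F"
      and bij: "bij_betw \<phi> (carrier (direct_sum P Q)) (carrier F)"
    using summand by (auto simp: summand_of_free_def lin_iso_def)
  interpret Q: supermodule R Q by (rule Q)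
  obtain K :: "('u + 'u) set" and f where F: "supermodule R F" and basis: "is_basis R F K f"
    using free by (auto simp: free_of_type_def)
  let ?S = "direct_sum P Q"
  define \<psi> where "\<psi> = inv_into (carrier ?S) \<phi>"
  have \<psi>: "\<psi> \<in> lin_hom R F ?S"
    unfolding \<psi>_def using \<phi> bij
    by (rule lin_hom_inv_into) (auto simp: direct_sum_def P.ract_closed Q.ract_closed)
  have incl: "(\<lambda>x. (x, \<zero>\<^bsub>Q\<^esub>)) \<in> lin_hom R P ?S"
    by (rule lin_homI) (auto simp: direct_sum_def Q.zero_ract)
  have proj: "fst \<in> lin_hom R ?S P"
    by (rule lin_homI) (auto simp: direct_sum_def)
  have retract: "fst (\<psi> (\<phi> (x, \<zero>\<^bsub>Q\<^esub>))) = x" if "x \<in> carrier P" for x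
    using bij lin_hom_closed[OF incl that] unfolding \<psi>_def
    by (simp add: bij_betw_def inv_into_f_f)
  show ?thesis
    unfolding lifting_property_def
  proof (intro allI impI)
    fix M N :: "('r, 'v) supermodule" and h g
    assume M: "supermodule R M" and N: "supermodule R N" and h: "h \<in> lin_hom R P N"
      and g: "g \<in> lin_hom R M N" and surj: "g ` carrier M = carrier N"
    have "(\<lambda>y. h (fst (\<psi> y))) \<in> lin_hom R F N"
      by (rule lin_hom_compose[OF lin_hom_compose[OF \<psi> proj] h])
    then obtain k where k: "k \<in> lin_hom R F M" "\<And>y. y \<in> carrier F \<Longrightarrow> g (k y) = h (fst (\<psi> y))"
      using basis_lift[OF F basis M N _ g surj] by blast
    have "(\<lambda>x. k (\<phi> (x, \<zero>\<^bsub>Q\<^esub>))) \<in> lin_hom R P M"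
      using lin_hom_compose[OF lin_hom_compose[OF incl \<phi>] k(1)] .
    moreover have "g (k (\<phi> (x, \<zero>\<^bsub>Q\<^esub>))) = h x" if "x \<in> carrier P" for x
      using k(2) retract that lin_hom_closed[OF \<phi> lin_hom_closed[OF incl that]] by simp
    ultimately show "\<exists>h' \<in> lin_hom R P M. \<forall>x \<in> carrier P. g (h' x) = h x"
      by (intro bexI ballI)
  qed
qed


section \<open>Copies of supermodules on other types\<close>

text \<open>
  Transport of structure along an injection \<open>j\<close>. The values of the operations outside the range of
  \<open>j\<close> are arbitrary.
\<close>

definition copy_along ::
  "('m \<Rightarrow> 'u) \<Rightarrow> ('r, 'm, 'b) supermodule_scheme \<Rightarrow> ('r, 'u) supermodule" where
  "copy_along j M =
    \<lparr>carrier = j ` carrier M,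
     mult = undefined,
     one = undefined,
     zero = j \<zero>\<^bsub>M\<^esub>,
     add = (\<lambda>x y. j (inv_into UNIV j x \<oplus>\<^bsub>M\<^esub> inv_into UNIV j y)),
     gr = (\<lambda>\<alpha>. j ` gr M \<alpha>),
     ract = (\<lambda>x a. j (inv_into UNIV j x \<cdot>\<^bsub>M\<^esub> a))\<rparr>"

lemma supermodule_copy:
  assumes M: "supermodule R M" and j: "inj j"
  shows "supermodule R (copy_along j M)"
proof -
  interpret supermodule R M by (rule M)
  let ?C = "copy_along j M"
  have simps: "carrier ?C = j ` carrier M" "\<zero>\<^bsub>?C\<^esub> = j \<zero>\<^bsub>M\<^esub>" "gr ?C \<alpha> = j ` gr M \<alpha>"
    "j x \<oplus>\<^bsub>?C\<^esub> j y = j (x \<oplus>\<^bsub>M\<^esub> y)" "j x \<cdot>\<^bsub>?C\<^esub> a = j (x \<cdot>\<^bsub>M\<^esub> a)" for \<alpha> x y a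
    using j by (simp_all add: copy_along_def inv_f_f)
  have group: "abelian_group ?C"
  proof (rule abelian_groupI)
    fix x assume "x \<in> carrier ?C"
    then obtain x' where "x' \<in> carrier M" "x = j x'" by (auto simp: simps)
    then show "\<exists>y\<in>carrier ?C. y \<oplus>\<^bsub>?C\<^esub> x = \<zero>\<^bsub>?C\<^esub>"
      by (auto simp: simps M.l_neg intro!: bexI[of _ "\<ominus>\<^bsub>M\<^esub> x'"])
  qed (auto simp: simps M.a_ac)
  have "z2_decomposition ?C"
  proof (rule z2_decompositionI[OF group])
    fix \<alpha> x assume "x \<in> gr ?C \<alpha>"
    then obtain x' where "x' \<in> gr M \<alpha>" "x = j x'" by (auto simp: simps)
    then show "\<exists>y\<in>gr ?C \<alpha>. y \<oplus>\<^bsub>?C\<^esub> x = \<zero>\<^bsub>?C\<^esub>"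
      using gr_subset z2_neg[OF decomposition M.abelian_group_axioms]
      by (auto simp: simps M.l_neg subset_iff intro!: bexI[of _ "\<ominus>\<^bsub>M\<^esub> x'"])
  next
    fix x assume "x \<in> carrier ?C"
    then obtain x' where "x' \<in> carrier M" "x = j x'" by (auto simp: simps)
    then show "\<exists>x0\<in>gr ?C 0. \<exists>x1\<in>gr ?C 1. x = x0 \<oplus>\<^bsub>?C\<^esub> x1"
      by (auto simp: simps elim!: z2_obtain[OF decomposition])
  next
    fix x assume "x \<in> gr ?C 0" "x \<in> gr ?C 1"
    then show "x = \<zero>\<^bsub>?C\<^esub>"
      using j z2_disjoint[OF decomposition] by (auto simp: simps inj_eq)
  qed (use gr_subset in \<open>auto simp: simps z2_zero z2_add decomposition\<close>)
  then show ?thesis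
    using group R.superring_axioms
    by (intro supermodule.intro supermodule_axioms.intro)
       (auto simp: simps ract_closed ract_add_left ract_add_right ract_mult ract_one ract_graded)
qed

lemma copy_lin_hom: "inj j \<Longrightarrow> j \<in> lin_hom R M (copy_along j M)"
  by (rule lin_homI) (auto simp: copy_along_def)

lemma copy_lin_hom_inv:
  assumes "supermodule R M" "inj j"
  shows "inv_into UNIV j \<in> lin_hom R (copy_along j M) M"
proof -
  interpret supermodule R M by fact
  show ?thesis using assms(2)
    by (intro lin_homI) (auto simp: copy_along_def ract_closed)
qed

lemma copy_bij: "inj j \<Longrightarrow> bij_betw j (carrier M) (carrier (copy_along j M))"
  by (auto simp: copy_along_def bij_betw_def inj_on_def)

text \<open>
  A splitting is a lift of the identity of \<open>P\<close> along \<open>g\<close>. As the target of a lifting problem has to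
  live on \<open>'u\<close>, the identity is replaced by the isomorphism \<open>j\<close> onto a copy of \<open>P\<close>, and \<open>g\<close> by \<open>j \<circ> g\<close>.
\<close>

lemma lifting_sequences_split:
  fixes P :: "('r, 'p, 'b) supermodule_scheme" and j :: "'p \<Rightarrow> 'u"
  assumes P: "supermodule R P" and j: "inj j" and lifting: "lifting_property TYPE('u) R P"
  shows "sequences_split TYPE('u) R P"
  unfolding sequences_split_def
proof (intro allI impI)
  fix E1 E2 :: "('r, 'u) supermodule" and h g
  assume E2: "supermodule R E2" and exact: "short_exact R E1 E2 P h g"
  let ?N = "copy_along j P"
  have g: "g \<in> lin_hom R E2 P" and surj: "g ` carrier E2 = carrier P"
    using exact by (auto simp: short_exact_def)
  have "(\<lambda>x. j (g x)) \<in> lin_hom R E2 ?N"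
    using g copy_lin_hom[OF j] by (rule lin_hom_compose)
  moreover have "(\<lambda>x. j (g x)) ` carrier E2 = carrier ?N"
    using surj by (auto simp: copy_along_def simp flip: image_image)
  ultimately obtain s where "s \<in> lin_hom R P E2" "\<And>x. x \<in> carrier P \<Longrightarrow> j (g (s x)) = j x"
    using lifting[unfolded lifting_property_def, rule_format,
        OF E2 supermodule_copy[OF P j] copy_lin_hom[OF j]] by metis
  then show "\<exists>s \<in> lin_hom R P E2. \<forall>x \<in> carrier P. g (s x) = x"
    using j by (auto simp: inj_eq)
qed


section \<open>Kernels\<close>

definition kernel_supermodule ::
  "('r, 'm, 'b) supermodule_scheme \<Rightarrow> ('r, 'n, 'c) supermodule_scheme \<Rightarrow> ('m \<Rightarrow> 'n) \<Rightarrow>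
   ('r, 'm, 'b) supermodule_scheme" where
  "kernel_supermodule M N g =
    M\<lparr>carrier := {x \<in> carrier M. g x = \<zero>\<^bsub>N\<^esub>}, gr := \<lambda>\<alpha>. {x \<in> gr M \<alpha>. g x = \<zero>\<^bsub>N\<^esub>}\<rparr>"

text \<open>
  For a morphism of degree \<open>0\<close>, the images of the two components of a kernel element are negatives
  of each other and of different degrees. Hence both vanish and the components lie in the kernel.
  For a morphism that is not homogeneous this fails, and the kernel need not be graded.
\<close>

lemma supermodule_kernel:
  assumes M: "supermodule R M" and N: "supermodule R N" and g: "g \<in> lin_hom R M N"
    and graded: "\<And>\<alpha> x. x \<in> gr M \<alpha> \<Longrightarrow> g x \<in> gr N \<alpha>"
  shows "supermodule R (kernel_supermodule M N g)"
proof -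
  interpret M: supermodule R M by (rule M)
  interpret N: supermodule R N by (rule N)
  let ?K = "kernel_supermodule M N g"
  have simps: "carrier ?K = {x \<in> carrier M. g x = \<zero>\<^bsub>N\<^esub>}" "\<zero>\<^bsub>?K\<^esub> = \<zero>\<^bsub>M\<^esub>"
    "gr ?K \<alpha> = {x \<in> gr M \<alpha>. g x = \<zero>\<^bsub>N\<^esub>}"
    "x \<oplus>\<^bsub>?K\<^esub> y = x \<oplus>\<^bsub>M\<^esub> y" "x \<cdot>\<^bsub>?K\<^esub> a = x \<cdot>\<^bsub>M\<^esub> a" for \<alpha> x y a
    by (simp_all add: kernel_supermodule_def)
  have gzero: "g \<zero>\<^bsub>M\<^esub> = \<zero>\<^bsub>N\<^esub>" using M N g by (rule lin_hom_zero)
  have gneg: "g (\<ominus>\<^bsub>M\<^esub> x) = \<zero>\<^bsub>N\<^esub>" if x: "x \<in> carrier M" "g x = \<zero>\<^bsub>N\<^esub>" for x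
  proof -
    have "g (\<ominus>\<^bsub>M\<^esub> x) \<oplus>\<^bsub>N\<^esub> g x = \<zero>\<^bsub>N\<^esub>"
      using x gzero lin_hom_add[OF g, of "\<ominus>\<^bsub>M\<^esub> x" x] by (simp add: M.M.l_neg)
    then show ?thesis using x lin_hom_closed[OF g, of "\<ominus>\<^bsub>M\<^esub> x"] by simp
  qed
  have grM: "x \<in> gr M \<alpha> \<Longrightarrow> x \<in> carrier M" for x \<alpha> using M.gr_subset by blast
  have group: "abelian_group ?K"
  proof (rule abelian_groupI)
    fix x assume "x \<in> carrier ?K"
    then show "\<exists>y\<in>carrier ?K. y \<oplus>\<^bsub>?K\<^esub> x = \<zero>\<^bsub>?K\<^esub>"
      by (auto simp: simps gneg M.M.l_neg intro!: bexI[of _ "\<ominus>\<^bsub>M\<^esub> x"])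
  qed (auto simp: simps gzero lin_hom_add[OF g] M.M.a_ac)
  have "z2_decomposition ?K"
  proof (rule z2_decompositionI[OF group])
    fix \<alpha> x assume "x \<in> gr ?K \<alpha>"
    then show "\<exists>y\<in>gr ?K \<alpha>. y \<oplus>\<^bsub>?K\<^esub> x = \<zero>\<^bsub>?K\<^esub>"
      using z2_neg[OF M.decomposition M.M.abelian_group_axioms]
      by (intro bexI[of _ "\<ominus>\<^bsub>M\<^esub> x"]) (auto simp: simps gneg grM M.M.l_neg)
  next
    fix x assume "x \<in> carrier ?K"
    then have x: "x \<in> carrier M" "g x = \<zero>\<^bsub>N\<^esub>" by (auto simp: simps)
    then obtain x0 x1 where d: "x0 \<in> gr M 0" "x1 \<in> gr M 1" "x = x0 \<oplus>\<^bsub>M\<^esub> x1"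
      by (auto elim: z2_obtain[OF M.decomposition])
    have in_N: "g x0 \<in> carrier N" "g x1 \<in> carrier N"
      using d grM lin_hom_closed[OF g] by auto
    have sum: "g x0 \<oplus>\<^bsub>N\<^esub> g x1 = \<zero>\<^bsub>N\<^esub>"
      using x d grM lin_hom_add[OF g] by metis
    then have "g x0 = \<ominus>\<^bsub>N\<^esub> g x1"
      using in_N by (metis N.M.minus_equality)
    then have "g x0 \<in> gr N 1"
      using z2_neg[OF N.decomposition N.M.abelian_group_axioms graded[OF d(2)]] by simp
    then have "g x0 = \<zero>\<^bsub>N\<^esub>"
      using z2_disjoint[OF N.decomposition graded[OF d(1)]] by simp
    moreover from this sum have "g x1 = \<zero>\<^bsub>N\<^esub>" using in_N by simp
    ultimately show "\<exists>x0\<in>gr ?K 0. \<exists>x1\<in>gr ?K 1. x = x0 \<oplus>\<^bsub>?K\<^esub> x1"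
      using d by (auto simp: simps)
  qed (auto simp: simps grM gzero z2_zero z2_add z2_disjoint M.decomposition lin_hom_add[OF g])
  then show ?thesis
    using group M.R.superring_axioms M.gr_R_subset
    by (intro supermodule.intro supermodule_axioms.intro)
       (auto simp: simps lin_hom_ract[OF g] N.zero_ract grM subset_iff M.ract_closed
          M.ract_add_left M.ract_add_right M.ract_mult M.ract_one M.ract_graded)
qed


section \<open>The free supermodule on a set of graded generators\<close>

text \<open>
  The coordinates of an element of degree \<open>\<alpha>\<close> at a generator \<open>k\<close> of degree \<open>d k\<close> have degree
  \<open>\<alpha> - d k\<close>. The ring acts on the right, so no signs occur. Families vanish outside \<open>K\<close> to make equal
  elements equal as functions.
\<close>

definition free_supermodule ::
  "('r, 'a) z2graded_scheme \<Rightarrow> 'k set \<Rightarrow> ('k \<Rightarrow> 2) \<Rightarrow> ('r, 'k \<Rightarrow> 'r) supermodule" where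
  "free_supermodule R K d =
    \<lparr>carrier = {c \<in> coeffs R K. \<forall>k. k \<notin> K \<longrightarrow> c k = \<zero>\<^bsub>R\<^esub>},
     mult = undefined,
     one = undefined,
     zero = (\<lambda>k. \<zero>\<^bsub>R\<^esub>),
     add = (\<lambda>c c' k. c k \<oplus>\<^bsub>R\<^esub> c' k),
     gr = (\<lambda>\<alpha>. {c \<in> coeffs R K. (\<forall>k. k \<notin> K \<longrightarrow> c k = \<zero>\<^bsub>R\<^esub>) \<and> (\<forall>k \<in> K. c k \<in> gr R (\<alpha> - d k))}),
     ract = (\<lambda>c a k. c k \<otimes>\<^bsub>R\<^esub> a)\<rparr>"

definition unit_vector :: "('r, 'a) z2graded_scheme \<Rightarrow> 'k \<Rightarrow> 'k \<Rightarrow> 'r" where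
  "unit_vector R k l = (if l = k then \<one>\<^bsub>R\<^esub> else \<zero>\<^bsub>R\<^esub>)"

lemma supermodule_free:
  assumes R: "superring R"
  shows "supermodule R (free_supermodule R K d)"
proof -
  interpret superring R by (rule R)
  let ?F = "free_supermodule R K d"
  have simps: "carrier ?F = {c \<in> coeffs R K. \<forall>k. k \<notin> K \<longrightarrow> c k = \<zero>\<^bsub>R\<^esub>}"
    "gr ?F \<alpha> = {c \<in> coeffs R K.
      (\<forall>k. k \<notin> K \<longrightarrow> c k = \<zero>\<^bsub>R\<^esub>) \<and> (\<forall>k \<in> K. c k \<in> gr R (\<alpha> - d k))}"
    "\<zero>\<^bsub>?F\<^esub> = (\<lambda>k. \<zero>\<^bsub>R\<^esub>)" "x \<oplus>\<^bsub>?F\<^esub> y = (\<lambda>k. x k \<oplus>\<^bsub>R\<^esub> y k)"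
    "x \<cdot>\<^bsub>?F\<^esub> a = (\<lambda>k. x k \<otimes>\<^bsub>R\<^esub> a)" for \<alpha> x y a
    by (simp_all add: free_supermodule_def)
  have zero: "(\<lambda>k. \<zero>\<^bsub>R\<^esub>) \<in> coeffs R K" by (simp add: coeffs_def)
  have closed: "x k \<in> carrier R" if "x \<in> carrier ?F" for x k
    using that by (cases "k \<in> K") (auto simp: simps coeffs_def)
  have neg: "(\<lambda>k. \<ominus>\<^bsub>R\<^esub> x k) \<in> carrier ?F" if "x \<in> carrier ?F" for x
    using that by (simp add: simps coeffs_neg)
  have gr_closed: "x \<in> carrier ?F" if "x \<in> gr ?F \<alpha>" for x \<alpha>
    using that by (simp add: simps)
  have group: "abelian_group ?F"
  proof (rule abelian_groupI)
    fix x assume x: "x \<in> carrier ?F"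
    show "\<exists>y\<in>carrier ?F. y \<oplus>\<^bsub>?F\<^esub> x = \<zero>\<^bsub>?F\<^esub>"
      by (rule bexI[OF _ neg[OF x]]) (simp add: simps(3,4) closed[OF x] l_neg)
  next
    fix x y assume "x \<in> carrier ?F" "y \<in> carrier ?F"
    then show "x \<oplus>\<^bsub>?F\<^esub> y \<in> carrier ?F" by (simp add: simps coeffs_add)
  next
    show "\<zero>\<^bsub>?F\<^esub> \<in> carrier ?F" by (simp add: simps zero)
  qed (simp_all add: simps(3,4) closed a_ac)
  have "z2_decomposition ?F"
  proof (rule z2_decompositionI[OF group])
    fix \<alpha> x assume x: "x \<in> gr ?F \<alpha>"
    have "(\<lambda>k. \<ominus>\<^bsub>R\<^esub> x k) \<in> gr ?F \<alpha>"
      using x neg[OF gr_closed[OF x]] z2_neg[OF decomposition abelian_group_axioms]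
      by (simp add: simps)
    then show "\<exists>y\<in>gr ?F \<alpha>. y \<oplus>\<^bsub>?F\<^esub> x = \<zero>\<^bsub>?F\<^esub>"
      using closed[OF gr_closed[OF x]] by (intro bexI) (simp_all add: simps(3,4) l_neg)
  next
    fix x assume x: "x \<in> carrier ?F"
    obtain p where p: "\<And>\<alpha> r. r \<in> carrier R \<Longrightarrow> p \<alpha> r \<in> gr R \<alpha>"
      "\<And>r. r \<in> carrier R \<Longrightarrow> p 0 r \<oplus>\<^bsub>R\<^esub> p 1 r = r" "\<And>\<alpha>. p \<alpha> \<zero>\<^bsub>R\<^esub> = \<zero>\<^bsub>R\<^esub>"
      using gr_parts by blast
    \<comment> \<open>The component of degree \<open>\<alpha>\<close> takes at \<open>k\<close> the part of degree \<open>\<alpha> - d k\<close> of the coefficient, so at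
      odd generators the two parts of a coefficient change places.\<close>
    define y where "y \<alpha> k = p (\<alpha> - d k) (x k)" for \<alpha> k
    have "y \<alpha> \<in> gr ?F \<alpha>" for \<alpha>
    proof -
      have "{k \<in> K. y \<alpha> k \<noteq> \<zero>\<^bsub>R\<^esub>} \<subseteq> {k \<in> K. x k \<noteq> \<zero>\<^bsub>R\<^esub>}"
        using p(3) by (auto simp: y_def)
      moreover have "y \<alpha> k \<in> gr R (\<alpha> - d k)" for k
        using p(1) closed[OF x] by (simp add: y_def)
      moreover from this have "y \<alpha> k \<in> carrier R" for k
        using z2_subset[OF decomposition] by blast
      ultimately show ?thesis
        using x p(3) by (auto simp: simps coeffs_def y_def intro: finite_subset)
    qed
    moreover have "x = y 0 \<oplus>\<^bsub>?F\<^esub> y 1"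
    proof
      fix k
      have p01: "p 0 (x k) \<oplus>\<^bsub>R\<^esub> p 1 (x k) = x k" using p(2) closed[OF x] .
      have "p 0 (x k) \<in> carrier R" "p 1 (x k) \<in> carrier R"
        using p(1)[OF closed[OF x]] z2_subset[OF decomposition] by blast+
      with p01 have p10: "p 1 (x k) \<oplus>\<^bsub>R\<^esub> p 0 (x k) = x k" by (simp add: a_comm)
      show "x k = (y 0 \<oplus>\<^bsub>?F\<^esub> y 1) k"
        using two_cases[of "d k"] p01 p10 by (auto simp: simps y_def two_minus_one)
    qed
    ultimately show "\<exists>x0\<in>gr ?F 0. \<exists>x1\<in>gr ?F 1. x = x0 \<oplus>\<^bsub>?F\<^esub> x1" by blast
  next
    fix x assume x: "x \<in> gr ?F 0" "x \<in> gr ?F 1"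
    have "x k = \<zero>\<^bsub>R\<^esub>" for k
    proof (cases "k \<in> K")
      case True
      then have "x k \<in> gr R (0 - d k)" "x k \<in> gr R (1 - d k)"
        using x by (simp_all add: simps)
      then have "x k \<in> gr R 0 \<and> x k \<in> gr R 1"
        using two_cases[of "d k"] by (auto simp: two_minus_one)
      then show ?thesis using z2_disjoint[OF decomposition] by blast
    next
      case False
      then show ?thesis using x by (simp add: simps)
    qed
    then show "x = \<zero>\<^bsub>?F\<^esub>" by (auto simp: simps)
  qed (auto simp: simps zero coeffs_add z2_zero[OF decomposition] z2_add[OF decomposition])
  moreover have "x \<cdot>\<^bsub>?F\<^esub> a \<in> gr ?F (\<beta> + \<alpha>)"
    if x: "x \<in> gr ?F \<beta>" and a: "a \<in> gr R \<alpha>" for x a \<alpha> \<beta>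
  proof -
    have "a \<in> carrier R" using a z2_subset[OF decomposition] by blast
    moreover have "x k \<otimes>\<^bsub>R\<^esub> a \<in> gr R (\<beta> + \<alpha> - d k)" if "k \<in> K" for k
      using mult_graded[of "x k" "\<beta> - d k" a \<alpha>] x a that by (simp add: simps algebra_simps)
    ultimately show ?thesis
      using x by (simp add: simps coeffs_mult)
  qed
  moreover have "x \<cdot>\<^bsub>?F\<^esub> a \<in> carrier ?F" if "x \<in> carrier ?F" "a \<in> carrier R" for x a
    using that by (simp add: simps coeffs_mult)
  ultimately show ?thesis
    using group R
    by (intro supermodule.intro supermodule_axioms.intro)
       (simp_all add: simps(4,5) closed l_distr r_distr m_assoc)
qed

lemma unit_vector_gr:
  assumes "superring R" "k \<in> K"
  shows "unit_vector R k \<in> gr (free_supermodule R K d) (d k)"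
proof -
  interpret superring R by fact
  have "{l \<in> K. unit_vector R k l \<noteq> \<zero>\<^bsub>R\<^esub>} \<subseteq> {k}" by (auto simp: unit_vector_def)
  then have "unit_vector R k \<in> coeffs R K"
    by (auto simp: coeffs_def unit_vector_def intro: finite_subset)
  then show ?thesis
    using assms(2) one_even z2_zero[OF decomposition]
    by (auto simp: free_supermodule_def unit_vector_def)
qed

text \<open>
  Addition of families is pointwise, so evaluation at \<open>k\<close> is additive and may be pulled through the
  sum; only the summand of index \<open>k\<close> survives.
\<close>

lemma lincomb_unit_vectors:
  assumes R: "superring R" and c: "c \<in> coeffs R K" and k: "k \<in> K"
  shows "lincomb R (free_supermodule R K d) K (unit_vector R) c k = c k"
proof -
  let ?F = "free_supermodule R K d"
  let ?A = "{l \<in> K. c l \<noteq> \<zero>\<^bsub>R\<^esub>}"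
  interpret F: supermodule R ?F using R by (rule supermodule_free)
  have A: "finite ?A" and c_closed: "\<And>l. l \<in> K \<Longrightarrow> c l \<in> carrier R"
    using c by (auto simp: coeffs_def)
  have "lincomb R ?F K (unit_vector R) c k = (\<Oplus>\<^bsub>R\<^esub>l\<in>?A. (unit_vector R l \<cdot>\<^bsub>?F\<^esub> c l) k)"
    unfolding lincomb_def
  proof (rule additive_finsum[OF F.M.abelian_group_axioms F.R.abelian_group_axioms])
    show "(\<lambda>x. x k) \<in> carrier ?F \<rightarrow> carrier R"
      using k by (auto simp: free_supermodule_def coeffs_def)
    show "(\<lambda>l. unit_vector R l \<cdot>\<^bsub>?F\<^esub> c l) \<in> ?A \<rightarrow> carrier ?F"
    proof
      fix l assume "l \<in> ?A"
      then show "unit_vector R l \<cdot>\<^bsub>?F\<^esub> c l \<in> carrier ?F"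
        using unit_vector_gr[OF R, of l K d] F.gr_subset c_closed by (intro F.ract_closed) auto
    qed
  qed (simp add: free_supermodule_def)
  also have "\<dots> = (\<Oplus>\<^bsub>R\<^esub>l\<in>?A. if k = l then c l else \<zero>\<^bsub>R\<^esub>)"
    using c_closed
    by (intro F.R.finsum_cong') (auto simp: free_supermodule_def unit_vector_def)
  also have "\<dots> = c k"
  proof (cases "k \<in> ?A")
    case True
    then show ?thesis
      using A c_closed by (intro F.R.add.finprod_singleton) auto
  next
    case False
    then have "(\<Oplus>\<^bsub>R\<^esub>l\<in>?A. if k = l then c l else \<zero>\<^bsub>R\<^esub>) = \<zero>\<^bsub>R\<^esub>"
      by (intro F.R.add.finprod_one_eqI) auto
    then show ?thesis using False k by simp
  qed
  finally show ?thesis .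
qed

lemma unit_vectors_basis:
  assumes R: "superring R"
  shows "is_basis R (free_supermodule R K d) K (unit_vector R)"
proof -
  let ?F = "free_supermodule R K d"
  interpret F: supermodule R ?F using R by (rule supermodule_free)
  have unit: "unit_vector R \<in> K \<rightarrow> carrier ?F"
  proof
    fix k assume "k \<in> K"
    then have "unit_vector R k \<in> gr ?F (d k)" by (rule unit_vector_gr[OF R])
    then show "unit_vector R k \<in> carrier ?F" using F.gr_subset by blast
  qed
  have "x = lincomb R ?F K (unit_vector R) x" if x: "x \<in> carrier ?F" for x
  proof
    fix k
    have c: "x \<in> coeffs R K" using x by (simp add: free_supermodule_def)
    show "x k = lincomb R ?F K (unit_vector R) x k"
    proof (cases "k \<in> K")
      case True
      then show ?thesis using lincomb_unit_vectors[OF R c] by simp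
    next
      case False
      then show ?thesis
        using x F.lincomb_closed[OF unit c] by (simp add: free_supermodule_def)
    qed
  qed
  then have "\<forall>x \<in> carrier ?F. \<exists>c \<in> coeffs R K. x = lincomb R ?F K (unit_vector R) c"
    by (auto simp: free_supermodule_def)
  moreover have "c k = \<zero>\<^bsub>R\<^esub>"
    if "c \<in> coeffs R K" "lincomb R ?F K (unit_vector R) c = \<zero>\<^bsub>?F\<^esub>" "k \<in> K" for c k
    using lincomb_unit_vectors[OF R that(1,3), of d] that(2) by (simp add: free_supermodule_def)
  ultimately show ?thesis
    using unit by (auto simp: is_basis_def)
qed

text \<open>
  The injection \<open>e\<close> moves the generators to the type on which index sets are wanted.
\<close>

lemma free_of_type_free_supermodule:
  assumes R: "superring R" and e: "inj e"
  shows "free_of_type R (free_supermodule R K d) (e ` {k \<in> K. d k = 0}) (e ` {k \<in> K. d k = 1})"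
proof -
  let ?F = "free_supermodule R K d"
  let ?f = "\<lambda>l. unit_vector R (inv_into UNIV e l)"
  let ?I = "e ` {k \<in> K. d k = 0}" and ?J = "e ` {k \<in> K. d k = 1}"
  let ?\<sigma> = "case_sum (inv_into UNIV e) (inv_into UNIV e)"
  interpret F: supermodule R ?F using R by (rule supermodule_free)
  have "bij_betw ?\<sigma> (?I <+> ?J) K"
  proof (rule bij_betw_imageI)
    show "inj_on ?\<sigma> (?I <+> ?J)"
      using e by (auto simp: inj_on_def)
    show "?\<sigma> ` (?I <+> ?J) = K"
    proof
      show "?\<sigma> ` (?I <+> ?J) \<subseteq> K" using e by auto
      show "K \<subseteq> ?\<sigma> ` (?I <+> ?J)"
      proof
        fix k assume k: "k \<in> K"
        have \<sigma>: "k = ?\<sigma> (Inl (e k))" "k = ?\<sigma> (Inr (e k))" using e by auto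
        have "Inl (e k) \<in> (?I <+> ?J) \<or> Inr (e k) \<in> (?I <+> ?J)"
          using k two_cases[of "d k"] by auto
        then show "k \<in> ?\<sigma> ` (?I <+> ?J)"
          using image_eqI[where f = ?\<sigma>, OF \<sigma>(1)] image_eqI[where f = ?\<sigma>, OF \<sigma>(2)] by blast
      qed
    qed
  qed
  then have "is_basis R ?F (?I <+> ?J) (\<lambda>l. unit_vector R (?\<sigma> l))"
    by (rule F.is_basis_reindex[OF unit_vectors_basis[OF R]])
  also have "(\<lambda>l. unit_vector R (?\<sigma> l)) = case_sum ?f ?f"
    by (auto simp: fun_eq_iff split: sum.split)
  finally have "is_basis R ?F (?I <+> ?J) (case_sum ?f ?f)" .
  moreover have "?f \<in> ?I \<rightarrow> gr ?F 0" "?f \<in> ?J \<rightarrow> gr ?F 1"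
    using e by (auto simp: inv_f_f dest: unit_vector_gr[OF R, of _ K d])
  ultimately show ?thesis
    using F.supermodule_axioms by (auto simp: free_of_type_def)
qed

lemma free_of_type_copy:
  assumes free: "free_of_type R F I J" and j: "inj j"
  shows "free_of_type R (copy_along j F) I J"
proof -
  let ?C = "copy_along j F"
  obtain f0 f1 where F: "supermodule R F" and f0: "f0 \<in> I \<rightarrow> gr F 0" and f1: "f1 \<in> J \<rightarrow> gr F 1"
    and basis: "is_basis R F (I <+> J) (case_sum f0 f1)"
    using free by (auto simp: free_of_type_def)
  have "is_basis R ?C (I <+> J) (\<lambda>k. j (case_sum f0 f1 k))"
    using is_basis_iso[OF F supermodule_copy[OF F j] copy_lin_hom[OF j] copy_bij[OF j] basis] .
  also have "(\<lambda>k. j (case_sum f0 f1 k)) = case_sum (\<lambda>i. j (f0 i)) (\<lambda>i. j (f1 i))"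
    by (auto simp: fun_eq_iff split: sum.split)
  finally have "is_basis R ?C (I <+> J) (case_sum (\<lambda>i. j (f0 i)) (\<lambda>i. j (f1 i)))" .
  moreover have "(\<lambda>i. j (f0 i)) \<in> I \<rightarrow> gr ?C 0" "(\<lambda>i. j (f1 i)) \<in> J \<rightarrow> gr ?C 1"
    using f0 f1 by (auto simp: copy_along_def)
  ultimately show ?thesis
    using supermodule_copy[OF F j] by (auto simp: free_of_type_def)
qed


section \<open>Presenting a supermodule as a graded quotient of a free one\<close>

text \<open>
  The inverse of \<open>(x, q) \<mapsto> s x + q\<close> is \<open>y \<mapsto> (g y, y - s (g y))\<close>.
\<close>

lemma split_kernel_iso:
  assumes E: "supermodule R E" and P: "supermodule R P" and g: "g \<in> lin_hom R E P"
    and s: "s \<in> lin_hom R P E" and section_eq: "\<And>x. x \<in> carrier P \<Longrightarrow> g (s x) = x"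
  shows "lin_iso R (direct_sum P (kernel_supermodule E P g)) E"
proof -
  interpret E: supermodule R E by (rule E)
  interpret P: supermodule R P by (rule P)
  let ?S = "direct_sum P (kernel_supermodule E P g)"
  let ?\<phi> = "\<lambda>(x, q). s x \<oplus>\<^bsub>E\<^esub> q"
  have S: "carrier ?S = carrier P \<times> {q \<in> carrier E. g q = \<zero>\<^bsub>P\<^esub>}"
    "(x, q) \<oplus>\<^bsub>?S\<^esub> (x', q') = (x \<oplus>\<^bsub>P\<^esub> x', q \<oplus>\<^bsub>E\<^esub> q')"
    "(x, q) \<cdot>\<^bsub>?S\<^esub> a = (x \<cdot>\<^bsub>P\<^esub> a, q \<cdot>\<^bsub>E\<^esub> a)" for x q x' q' a
    by (simp_all add: direct_sum_def kernel_supermodule_def)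
  note s_closed = lin_hom_closed[OF s] and g_closed = lin_hom_closed[OF g]
  have g_\<phi>: "g (s x \<oplus>\<^bsub>E\<^esub> q) = x" if "x \<in> carrier P" "q \<in> carrier E" "g q = \<zero>\<^bsub>P\<^esub>" for x q
    using that by (simp add: lin_hom_add[OF g] s_closed section_eq)
  have "?\<phi> \<in> lin_hom R ?S E"
    by (rule lin_homI)
       (auto simp: S s_closed lin_hom_add[OF s] lin_hom_ract[OF s] E.M.a_ac E.ract_add_left E.ract_closed)
  moreover have "bij_betw ?\<phi> (carrier ?S) (carrier E)"
  proof (rule bij_betw_imageI)
    show "inj_on ?\<phi> (carrier ?S)"
    proof (rule inj_onI, clarsimp simp: S(1))
      fix x q x' q'
      assume x: "x \<in> carrier P" "x' \<in> carrier P" and q: "q \<in> carrier E" "q' \<in> carrier E"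
        and "g q = \<zero>\<^bsub>P\<^esub>" "g q' = \<zero>\<^bsub>P\<^esub>" and eq: "s x \<oplus>\<^bsub>E\<^esub> q = s x' \<oplus>\<^bsub>E\<^esub> q'"
      then have "x = x'" using g_\<phi> by metis
      then show "x = x' \<and> q = q'" using eq x q s_closed by simp
    qed
    show "?\<phi> ` carrier ?S = carrier E"
    proof
      show "?\<phi> ` carrier ?S \<subseteq> carrier E" by (auto simp: S(1) s_closed)
      show "carrier E \<subseteq> ?\<phi> ` carrier ?S"
      proof
        fix y assume y: "y \<in> carrier E"
        define x where "x = g y"
        define q where "q = \<ominus>\<^bsub>E\<^esub> s x \<oplus>\<^bsub>E\<^esub> y"
        have x: "x \<in> carrier P" and sx: "s x \<in> carrier E" and q: "q \<in> carrier E"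
          using y g_closed s_closed by (auto simp: x_def q_def)
        have y_eq: "y = s x \<oplus>\<^bsub>E\<^esub> q"
          using sx y by (simp add: q_def E.M.r_neg2)
        then have "x \<oplus>\<^bsub>P\<^esub> g q = x"
          using lin_hom_add[OF g sx q] x by (simp add: section_eq x_def)
        then have "g q = \<zero>\<^bsub>P\<^esub>" using x g_closed[OF q] by simp
        then have "(x, q) \<in> carrier ?S" using x q by (simp add: S(1))
        with y_eq show "y \<in> ?\<phi> ` carrier ?S" by (auto intro: rev_image_eqI)
      qed
    qed
  qed
  ultimately show ?thesis by (auto simp: lin_iso_def)
qed

text \<open>
  The element \<open>\<zero>\<close> is both even and odd; it is counted among the even generators, so that a single set
  of generators within the carrier of \<open>P\<close> suffices. This keeps the free cover on the type of functions
  from the carrier type of \<open>P\<close>.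
\<close>

definition gen_degree :: "('r, 'p, 'b) supermodule_scheme \<Rightarrow> 'p \<Rightarrow> 2" where
  "gen_degree P k = (if k \<in> gr P 0 then 0 else 1)"

abbreviation free_cover ::
  "('r, 'a) z2graded_scheme \<Rightarrow> ('r, 'p, 'b) supermodule_scheme \<Rightarrow> ('r, 'p \<Rightarrow> 'r) supermodule" where
  "free_cover R P \<equiv> free_supermodule R (gr P 0 \<union> gr P 1) (gen_degree P)"

text \<open>
  Evaluation sends the generator named \<open>k\<close> to \<open>k\<close>. A term \<open>k \<cdot> c k\<close> of an element of degree \<open>\<alpha>\<close> has
  degree \<open>deg k + (\<alpha> - deg k) = \<alpha>\<close>, and every element of \<open>P\<close> is a sum of two generators.
\<close>

lemma free_cover_eval:
  fixes P :: "('r, 'p, 'b) supermodule_scheme"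
  assumes P: "supermodule R P"
  defines "\<epsilon> \<equiv> lincomb R P (gr P 0 \<union> gr P 1) (\<lambda>k. k)"
  shows "\<epsilon> \<in> lin_hom R (free_cover R P) P"
    and "\<epsilon> ` carrier (free_cover R P) = carrier P"
    and "c \<in> gr (free_cover R P) \<alpha> \<Longrightarrow> \<epsilon> c \<in> gr P \<alpha>"
proof -
  interpret P: supermodule R P by (rule P)
  let ?K = "gr P 0 \<union> gr P 1"
  let ?F = "free_cover R P"
  interpret F: supermodule R ?F using P.R.superring_axioms by (rule supermodule_free)
  have K: "(\<lambda>k. k) \<in> ?K \<rightarrow> carrier P" using P.gr_subset by auto
  have simps: "c \<in> carrier ?F \<Longrightarrow> c \<in> coeffs R ?K" "c \<oplus>\<^bsub>?F\<^esub> c' = (\<lambda>k. c k \<oplus>\<^bsub>R\<^esub> c' k)"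
    "c \<cdot>\<^bsub>?F\<^esub> a = (\<lambda>k. c k \<otimes>\<^bsub>R\<^esub> a)" for c c' a
    by (simp_all add: free_supermodule_def)
  show hom: "\<epsilon> \<in> lin_hom R ?F P"
    unfolding \<epsilon>_def
    by (rule lin_homI)
       (simp_all add: simps P.lincomb_closed[OF K] P.lincomb_add[OF K] P.lincomb_ract[OF K])
  show "\<epsilon> c \<in> gr P \<alpha>" if c: "c \<in> gr ?F \<alpha>" for c \<alpha>
    unfolding \<epsilon>_def lincomb_def
  proof (rule finsum_in_gr[OF P.decomposition P.M.abelian_group_axioms])
    fix k assume "k \<in> {k \<in> ?K. c k \<noteq> \<zero>\<^bsub>R\<^esub>}"
    then have "k \<in> gr P (gen_degree P k)" "c k \<in> gr R (\<alpha> - gen_degree P k)"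
      using c by (auto simp: gen_degree_def free_supermodule_def)
    then show "k \<cdot>\<^bsub>P\<^esub> c k \<in> gr P \<alpha>"
      using P.ract_graded by fastforce
  qed
  have eval_unit: "\<exists>c\<in>carrier ?F. \<epsilon> c = k" if k: "k \<in> ?K" for k
  proof
    show "unit_vector R k \<in> carrier ?F"
      using unit_vector_gr[OF P.R.superring_axioms k] F.gr_subset by blast
    then have c: "unit_vector R k \<in> ?K \<rightarrow> carrier R"
      using simps(1) by (auto simp: coeffs_def)
    have "\<epsilon> (unit_vector R k) = (\<Oplus>\<^bsub>P\<^esub>l\<in>{k}. l \<cdot>\<^bsub>P\<^esub> unit_vector R k l)"
      unfolding \<epsilon>_def using k
      by (intro P.lincomb_superset[OF K c]) (auto simp: unit_vector_def)
    then show "\<epsilon> (unit_vector R k) = k"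
      using k K by (auto simp: unit_vector_def P.ract_one P.M.finsum_insert Pi_iff)
  qed
  show "\<epsilon> ` carrier ?F = carrier P"
  proof
    show "\<epsilon> ` carrier ?F \<subseteq> carrier P" using lin_hom_closed[OF hom] by auto
    show "carrier P \<subseteq> \<epsilon> ` carrier ?F"
    proof
      fix x assume "x \<in> carrier P"
      then obtain x0 x1 where x: "x0 \<in> gr P 0" "x1 \<in> gr P 1" "x = x0 \<oplus>\<^bsub>P\<^esub> x1"
        by (auto elim: z2_obtain[OF P.decomposition])
      obtain c0 c1 where "c0 \<in> carrier ?F" "\<epsilon> c0 = x0" "c1 \<in> carrier ?F" "\<epsilon> c1 = x1"
        using eval_unit x by blast
      then show "x \<in> \<epsilon> ` carrier ?F"
        using x lin_hom_add[OF hom] by (intro image_eqI[of _ _ "c0 \<oplus>\<^bsub>?F\<^esub> c1"]) auto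
    qed
  qed
qed

text \<open>
  The sequence to split is the inclusion of the graded kernel of evaluation, followed by evaluation
  on a copy of the free cover.
\<close>

lemma sequences_split_summand:
  fixes P :: "('r, 'p, 'b) supermodule_scheme" and e :: "'p \<Rightarrow> 'u" and j :: "('p \<Rightarrow> 'r) \<Rightarrow> 'u"
  assumes P: "supermodule R P" and e: "inj e" and j: "inj j"
    and split: "sequences_split TYPE('u) R P"
  shows "summand_of_free TYPE('u) R P"
proof -
  interpret P: supermodule R P by (rule P)
  define \<epsilon> where "\<epsilon> = lincomb R P (gr P 0 \<union> gr P 1) (\<lambda>k. k)"
  note eval = free_cover_eval[OF P, folded \<epsilon>_def]
  note cover = supermodule_free[OF P.R.superring_axioms]
  let ?F = "copy_along j (free_cover R P)"
  define g where "g y = \<epsilon> (inv_into UNIV j y)" for y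
  let ?Q = "kernel_supermodule ?F P g"
  have F: "supermodule R ?F" using cover j by (rule supermodule_copy)
  have g: "g \<in> lin_hom R ?F P"
    unfolding g_def using copy_lin_hom_inv[OF cover j] eval(1) by (rule lin_hom_compose)
  have surj: "g ` carrier ?F = carrier P"
    using j eval(2) by (simp add: g_def copy_along_def image_image)
  have "g y \<in> gr P \<alpha>" if "y \<in> gr ?F \<alpha>" for y \<alpha>
    using that j eval(3) by (auto simp: g_def copy_along_def)
  then have Q: "supermodule R ?Q"
    by (rule supermodule_kernel[OF F P g])
  have "short_exact R ?Q ?F P (\<lambda>x. x) g"
    using g surj by (auto simp: short_exact_def kernel_supermodule_def lin_hom_def)
  then obtain s where s: "s \<in> lin_hom R P ?F" "\<And>x. x \<in> carrier P \<Longrightarrow> g (s x) = x"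
    using split[unfolded sequences_split_def, rule_format, OF Q F] by blast
  have "lin_iso R (direct_sum P ?Q) ?F"
    using split_kernel_iso[OF F P g s] .
  moreover have "\<exists>(I :: 'u set) (J :: 'u set). free_of_type R ?F I J"
    by (intro exI)
       (rule free_of_type_copy[OF free_of_type_free_supermodule[OF P.R.superring_axioms e] j])
  ultimately show ?thesis
    using Q unfolding summand_of_free_def by blast
qed


section \<open>The three characterisations of projectivity\<close>

theorem theorem3p1:
  fixes R :: "'r z2graded" and P :: "('r, 'p) supermodule"
  assumes "supercommutative_ring R" and "supermodule R P"
  shows "(summand_of_free TYPE(('r, 'p, 'x) universe) R P \<longleftrightarrow>
          lifting_property TYPE(('r, 'p, 'x) universe) R P) \<and>
         (lifting_property TYPE(('r, 'p, 'x) universe) R P \<longleftrightarrow>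
          sequences_split TYPE(('r, 'p, 'x) universe) R P)"
proof -
  have e: "inj (Inr \<circ> Inl :: 'p \<Rightarrow> ('r, 'p, 'x) universe)"
    and j: "inj (Inl :: ('p \<Rightarrow> 'r) \<Rightarrow> ('r, 'p, 'x) universe)"
    by (auto simp: inj_def)
  show ?thesis
    using summand_of_free_lifting[OF assms(2)] lifting_sequences_split[OF assms(2) e]
      sequences_split_summand[OF assms(2) e j]
    by blast
qed

end
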